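(* Let $f\in DT(\mathrm{T}^2)$ and let $\widehat{f}\in DT(S^1\times\mathbb{R})$ be a lift of $f$. Suppose that $f$ is minimal. Then $\rho_V(\widehat{f})=\{\alpha\}$ for some irrational number $\alpha$.
   Context: $\mathrm{T}^2=\mathbb{R}^2/\mathbb{Z}^2$ is the flat torus, and $S^1=\mathbb{R}/\mathbb{Z}$, so $S^1\times\mathbb{R}$ is a cylinder covering $\mathrm{T}^2$ in the natural way. $DT(\mathrm{T}^2)$ is the set of homeomorphisms of $\mathrm{T}^2$ homotopic to a Dehn twist $(x,y)\mapsto (x+ky \bmod 1,\ y \bmod 1)$ for some integer $k\neq 0$. $DT(S^1\times\mathbb{R})$ is the set of lifts of elements of $DT(\mathrm{T}^2)$ to $S^1\times\mathbb{R}$. $p_2:S^1\times\mathbb{R}\to\mathbb{R}$ is the projection on the second coordinate. The vertical rotation set of $\widehat{f}$ is $$\rho_V(\widehat{f})=\bigcap_{i\geq 1}\overline{\bigcup_{n\geq i}\left\{\frac{p_2\circ\widehat{f}^n(\widehat{z})-p_2(\widehat{z})}{n}:\ \widehat{z}\in S^1\times\mathbb{R}\right\}}.$$ It is a nonempty closed interval, possibly a single point. A homeomorphism is minimal if every orbit is dense. *)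

theory Defs
  imports "HOL-Analysis.Analysis"
begin

definition int_diff :: "real \<Rightarrow> real \<Rightarrow> bool" where
  "int_diff x y \<longleftrightarrow> x - y \<in> \<int>"

lemma equivp_int_diff: "equivp int_diff"
proof (rule equivpI)
  show "reflp int_diff"
    by (simp add: reflp_def int_diff_def)
  show "symp int_diff"
    unfolding symp_def int_diff_def by (metis Ints_minus minus_diff_eq)
  show "transp int_diff"
    unfolding transp_def int_diff_def by (metis Ints_add diff_add_cancel add_diff_eq)
qed

quotient_type circle = real / int_diff
  morphisms rep_circle to_circle
  by (rule equivp_int_diff)

lemma to_circle_eq_iff: "to_circle x = to_circle y \<longleftrightarrow> x - y \<in> \<int>"
  by (simp add: circle.abs_eq_iff int_diff_def)

lemma surj_to_circle: "surj to_circle"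
  by (metis Quotient3_abs_rep Quotient3_circle surj_def)

instantiation circle :: topological_space
begin

definition open_circle :: "circle set \<Rightarrow> bool" where
  "open_circle U \<longleftrightarrow> open (to_circle -` U)"

instance
  by standard (auto simp: open_circle_def vimage_Union)

end

lemma continuous_to_circle: "continuous_on UNIV to_circle"
  by (auto simp: continuous_on_open_vimage open_circle_def)

lemma open_to_circle_image:
  assumes "open U"
  shows "open (to_circle ` U)"
proof -
  have "to_circle -` (to_circle ` U) = (\<Union>n\<in>\<int>. (+) n ` U)" (is "?L = ?R")
  proof
    show "?L \<subseteq> ?R"
    proof
      fix x assume "x \<in> ?L"
      then obtain u where u: "u \<in> U" "x - u \<in> \<int>"
        by (auto simp: to_circle_eq_iff)
      moreover have "x = (x - u) + u" by simp
      ultimately show "x \<in> ?R" by blast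
    qed
    show "?R \<subseteq> ?L"
    proof
      fix x assume "x \<in> ?R"
      then obtain n u where "n \<in> \<int>" "u \<in> U" "x = n + u" by blast
      then have "to_circle x = to_circle u" by (simp add: to_circle_eq_iff)
      with \<open>u \<in> U\<close> show "x \<in> ?L" by simp
    qed
  qed
  then show ?thesis
    using assms by (auto simp: open_circle_def intro!: open_translation)
qed

text \<open>The torus is taken as \<open>(\<real>/\<int>) \<times> (\<real>/\<int>)\<close> with the product topology. The
  lemmas \<open>torus_proj_eq_iff\<close>, \<open>surj_torus_proj\<close> and \<open>open_torus_iff\<close> say that this is
  exactly the quotient space \<open>\<real>\<^sup>2/\<int>\<^sup>2\<close>.\<close>

type_synonym torus = "circle \<times> circle"
type_synonym cylinder = "circle \<times> real"

definition torus_proj :: "real \<times> real \<Rightarrow> torus" where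
  "torus_proj = map_prod to_circle to_circle"

definition cylinder_proj :: "cylinder \<Rightarrow> torus" where
  "cylinder_proj = map_prod id to_circle"

lemma torus_proj_eq_iff:
  "torus_proj (x, y) = torus_proj (x', y') \<longleftrightarrow> x - x' \<in> \<int> \<and> y - y' \<in> \<int>"
  by (simp add: torus_proj_def to_circle_eq_iff)

lemma surj_torus_proj: "surj torus_proj"
  unfolding torus_proj_def by (intro map_prod_surj surj_to_circle)

lemma open_torus_iff: "open U \<longleftrightarrow> open (torus_proj -` U)"
proof
  have "continuous_on UNIV torus_proj"
    unfolding torus_proj_def map_prod_def case_prod_beta
    by (intro continuous_on_Pair continuous_on_compose2[OF continuous_to_circle]
        continuous_on_fst continuous_on_snd continuous_on_id) auto
  moreover assume "open U"
  ultimately show "open (torus_proj -` U)"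
    by (simp add: continuous_on_open_vimage)
next
  assume op: "open (torus_proj -` U)"
  show "open U"
    unfolding open_prod_def
  proof
    fix p assume "p \<in> U"
    obtain q where q: "p = torus_proj q" by (metis surj_torus_proj surjD)
    with \<open>p \<in> U\<close> have "q \<in> torus_proj -` U" by simp
    then obtain A B where AB: "open A" "open B" "q \<in> A \<times> B" "A \<times> B \<subseteq> torus_proj -` U"
      by (metis op open_prod_elim)
    have "open (to_circle ` A)" "open (to_circle ` B)"
      using AB by (auto intro: open_to_circle_image)
    moreover have "p \<in> to_circle ` A \<times> to_circle ` B"
      using AB q by (auto simp: torus_proj_def)
    moreover have "to_circle ` A \<times> to_circle ` B \<subseteq> U"
      using AB(4) by (auto simp: torus_proj_def)
    ultimately show "\<exists>A B. open A \<and> open B \<and> p \<in> A \<times> B \<and> A \<times> B \<subseteq> U"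
      by blast
  qed
qed

lift_definition circle_shear :: "int \<Rightarrow> circle \<Rightarrow> circle \<Rightarrow> circle"
  is "\<lambda>k x y. x + of_int k * y"
proof -
  fix k :: int and x x' y y' :: real
  assume "int_diff x x'" "int_diff y y'"
  then have "(x - x') + of_int k * (y - y') \<in> \<int>"
    by (auto simp: int_diff_def)
  then show "int_diff (x + of_int k * y) (x' + of_int k * y')"
    by (simp add: int_diff_def algebra_simps)
qed

definition dehn_twist :: "int \<Rightarrow> torus \<Rightarrow> torus" where
  "dehn_twist k = (\<lambda>(a, b). (circle_shear k a b, b))"

lemma dehn_twist_torus_proj:
  "dehn_twist k (torus_proj (x, y)) = torus_proj (x + of_int k * y, y)"
  by (simp add: dehn_twist_def torus_proj_def circle_shear.abs_eq)

definition DT_torus :: "(torus \<Rightarrow> torus) set" where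
  "DT_torus = {f. (\<exists>g. homeomorphism UNIV UNIV f g) \<and>
     (\<exists>k. k \<noteq> 0 \<and> homotopic_with_canon (\<lambda>_. True) UNIV UNIV f (dehn_twist k))}"

text \<open>Only continuity is demanded of a lift: a lift of an element of \<open>DT_torus\<close> commutes
  with the deck translations \<open>(a, t) \<mapsto> (a, t + m)\<close>, and is therefore a homeomorphism
  of the cylinder.\<close>

definition is_lift :: "(cylinder \<Rightarrow> cylinder) \<Rightarrow> (torus \<Rightarrow> torus) \<Rightarrow> bool" where
  "is_lift F f \<longleftrightarrow> continuous_on UNIV F \<and> cylinder_proj \<circ> F = f \<circ> cylinder_proj"

definition DT_cylinder :: "(cylinder \<Rightarrow> cylinder) set" where
  "DT_cylinder = {F. \<exists>f\<in>DT_torus. is_lift F f}"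

definition vertical_rotation_set :: "(cylinder \<Rightarrow> cylinder) \<Rightarrow> real set" where
  "vertical_rotation_set F =
     (\<Inter>i\<in>{1::nat..}. closure (\<Union>n\<in>{i..}. {(snd ((F ^^ n) z) - snd z) / real n | z. True}))"

text \<open>The two-sided orbit of a bijection.\<close>

definition full_orbit :: "('a \<Rightarrow> 'a) \<Rightarrow> 'a \<Rightarrow> 'a set" where
  "full_orbit f z = range (\<lambda>n. (f ^^ n) z) \<union> range (\<lambda>n. (inv f ^^ n) z)"

definition minimal_homeo :: "('a::topological_space \<Rightarrow> 'a) \<Rightarrow> bool" where
  "minimal_homeo f \<longleftrightarrow> (\<forall>z. closure (full_orbit f z) = UNIV)"

end

theory Submission
  imports Defs
begin

text \<open>Lift \<open>f\<close> to a homeomorphism of the plane and let \<open>G\<close> be the composition of a power of the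
  lift with a vertical integer translation, corresponding to a rational number \<open>r\<close>.  Minimality
  excludes orbits of \<open>G\<close> with bounded heights, so if the heights drift to one side only they do so
  at a linear rate, and the rotation set lies strictly on one side of \<open>r\<close>.  If instead orbits
  rise and fall without bound, small discs return to integer translates of themselves both above
  and below.  Because of the twist, such returns can be concatenated so that the total horizontal
  displacement is \<open>j\<close> times the total time, for an integer \<open>j\<close>.  This is a closed chain of free
  discs for \<open>z \<mapsto> G z - j\<close>, which by Franks' lemma must then have a fixed point, contradicting
  minimality.  So the rotation set is nonempty and lies strictly on one side of every rational
  number, hence it consists of one irrational number.

  Franks' lemma rests on Brouwer's theorem that an orientation preserving homeomorphism of the plane
  without fixed points has no periodic points.  Points of period 2 are excluded by comparing
  continuous logarithms of \<open>h z - z\<close> and of the difference quotients of \<open>h\<close>; a longer period can be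
  shortened by composing \<open>h\<close> with homeomorphisms supported in sets disjoint from their images, which
  creates no fixed points.\<close>

section \<open>Brouwer homeomorphisms\<close>

text \<open>The obstacle is that only the heights of orbits are controlled: the horizontal drift of
  a rising or falling return is unknown. The twist removes this obstacle. A return with displacement
  \<open>(a1, B)\<close> in time \<open>N1\<close> and one with displacement
  \<open>(a2, - B)\<close> in time \<open>N2\<close> can be joined in two orders. Both loops have
  total height 0 and total time \<open>M = N1 + N2\<close>, but the segment run second is twisted by
  its new height, and the total drifts differ by \<open>k * B * M\<close>. The drifts per unit of
  time thus differ by a nonzero integer, and suitable repetitions of the two loops have an integral
  mean drift \<open>j\<close>. To treat every rational, minimality must pass to powers of the map.
  It does so because the plane is connected: a counting argument with semicontinuous finite sets,
  which also excludes bounded orbits. Lying strictly on one side of \<open>r\<close> comes from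
  compactness: heights that cannot stay bounded must drop within a uniform time.\<close>

lemma exp_valued_1_constant:
  fixes f :: "'a::topological_space \<Rightarrow> complex"
  assumes "connected S" "continuous_on S f" "\<And>x. x \<in> S \<Longrightarrow> exp (f x) = 1"
  obtains n :: int where "\<And>x. x \<in> S \<Longrightarrow> f x = 2 * of_int n * of_real pi * \<i>"
proof -
  have ex: "\<exists>n::int. f x = 2 * of_int n * of_real pi * \<i>" if xS: "x \<in> S" for x
  proof -
    obtain n :: int where "Re (f x) = 0" "Im (f x) = of_int (2 * n) * pi"
      using assms(3)[OF xS] by (auto simp: exp_eq_1)
    then show ?thesis by (intro exI[of _ n]) (simp add: complex_eq_iff)
  qed
  have "f constant_on S"
  proof (rule continuous_discrete_range_constant[OF assms(1,2)])
    fix x assume "x \<in> S"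
    then obtain n where n: "f x = 2 * of_int n * of_real pi * \<i>" using ex by blast
    have "2 * pi \<le> norm (f y - f x)" if y: "y \<in> S" "f y \<noteq> f x" for y
    proof -
      obtain m where m: "f y = 2 * of_int m * of_real pi * \<i>" using ex y by blast
      have "f y - f x = of_real (2 * pi * of_int (m - n)) * \<i>"
        by (simp add: m n algebra_simps)
      then have "norm (f y - f x) = 2 * pi * \<bar>of_int (m - n)\<bar>"
        by (simp only: norm_mult norm_of_real norm_ii) (simp add: abs_mult)
      moreover have "m \<noteq> n" using m n y by auto
      then have "1 \<le> \<bar>of_int (m - n) :: real\<bar>"
        by linarith
      ultimately show ?thesis
        using mult_left_mono[of 1 "\<bar>of_int (m - n) :: real\<bar>" "2 * pi"] by simp
    qed
    then show "\<exists>e>0. \<forall>y. y \<in> S \<and> f y \<noteq> f x \<longrightarrow> e \<le> norm (f y - f x)"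
      by (intro exI[of _ "2 * pi"]) auto
  qed
  then obtain c where c: "\<And>x. x \<in> S \<Longrightarrow> f x = c"
    by (auto simp: constant_on_def)
  show thesis
  proof (cases "S = {}")
    case False
    then obtain x where "x \<in> S" by auto
    then show thesis using ex[of x] c that by metis
  qed (use that in auto)
qed

text \<open>Staying at bounded distance from a shear serves as a substitute for preserving orientation; it is
  inherited by inverses and by compactly supported modifications.\<close>

definition near_shear :: "(complex \<Rightarrow> complex) \<Rightarrow> bool" where
  "near_shear h \<longleftrightarrow> (\<exists>(k::real) C. \<forall>z. norm (h z - (z + of_real (k * Im z))) \<le> C)"

definition brouwer_homeo :: "(complex \<Rightarrow> complex) \<Rightarrow> bool" where
  "brouwer_homeo h \<longleftrightarrow>
     (\<exists>g. homeomorphism UNIV UNIV h g) \<and> near_shear h \<and> (\<forall>z. h z \<noteq> z)"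

lemma brouwer_homeo_inj: "brouwer_homeo h \<Longrightarrow> inj h"
  unfolding brouwer_homeo_def homeomorphism_def inj_def by (metis UNIV_I)

lemma brouwer_homeo_cont: "brouwer_homeo h \<Longrightarrow> continuous_on S h"
  unfolding brouwer_homeo_def homeomorphism_def by (meson continuous_on_subset subset_UNIV)

section \<open>Winding of difference quotients and points of period 2\<close>

text \<open>With \<open>d = norm d * (c + \<i> * s)\<close> the quotient is
  \<open>1 + k * s * (c - \<i> * s) + e / d\<close>. Were it real and at most 0, its imaginary part
  would force \<open>k * s * s = Im (e / d)\<close>, hence \<open>\<bar>k * s\<bar> < 1/2\<close>,
  and then the real part would be positive. So on a large circle the principal logarithm of the
  quotient is available.\<close>

lemma shear_quotient_avoids_nonpos:
  fixes k C :: real and d e :: complex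
  assumes e: "norm e \<le> C" and d: "norm d > 2 * C" "norm d > 4 * \<bar>k\<bar> * C" 
  shows "(d + of_real (k * Im d) + e) / d \<notin> \<real>\<^sub>\<le>\<^sub>0"
proof
  assume neg: "(d + of_real (k * Im d) + e) / d \<in> \<real>\<^sub>\<le>\<^sub>0"
  have C0: "C \<ge> 0" using e norm_ge_zero[of e] by linarith
  have d0: "d \<noteq> 0" "norm d > 0" using d C0 by auto
  define s c where "s = Im d / norm d" and "c = Re d / norm d"
  have sc: "s\<^sup>2 + c\<^sup>2 = 1"
  proof -
    have "s\<^sup>2 + c\<^sup>2 = ((Re d)\<^sup>2 + (Im d)\<^sup>2) / (norm d)\<^sup>2"
      by (simp add: s_def c_def power_divide add_divide_distrib)
    then show ?thesis using d0 by (simp flip: cmod_power2)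
  qed
  have ds: "d = of_real (norm d) * Complex c s"
    using d0 by (simp add: complex_eq_iff s_def c_def)
  have id: "inverse (Complex c s) = Complex c (- s)"
    using sc by (simp add: complex_eq_iff add.commute)
  have q: "of_real (k * Im d) / d = of_real (k * s) * Complex c (- s)"
  proof -
    have "of_real (k * Im d) / d = of_real (k * (norm d * s)) / (of_real (norm d) * Complex c s)"
      using ds d0 by (metis s_def nonzero_mult_div_cancel_left order_less_irrefl times_divide_eq_right)
    also have "\<dots> = of_real (k * s) * inverse (Complex c s)"
      using d0 by (simp add: field_simps)
    finally show ?thesis by (simp add: id)
  qed
  define u where "u = (d + of_real (k * Im d) + e) / d"
  have u: "u = 1 + of_real (k * s) * Complex c (- s) + e / d"
    using d0 q by (simp add: u_def add_divide_distrib)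
  have ed: "norm (e / d) \<le> C / norm d"
    using e d0 by (simp add: norm_divide divide_right_mono)
  have e1: "C / norm d < 1/2" using d d0 by (simp add: field_simps)
  have e2: "\<bar>k\<bar> * (C / norm d) < 1/4" using d d0 by (simp add: field_simps)
  have "Im u = 0" "Re u \<le> 0" using neg by (auto simp: u_def complex_nonpos_Reals_iff)
  then have im: "k * s * s = Im (e / d)" and re: "1 + k * s * c + Re (e / d) \<le> 0"
    by (auto simp: u algebra_simps)
  have "\<bar>k * s * s\<bar> \<le> C / norm d" using im ed abs_Im_le_cmod[of "e/d"] by linarith
  then have "\<bar>k\<bar> * \<bar>k * s * s\<bar> < 1/4"
    using e2 mult_left_mono[of "\<bar>k * s * s\<bar>" "C / norm d" "\<bar>k\<bar>"] by linarith
  then have "(k * s)\<^sup>2 < (1/2)\<^sup>2" by (simp add: abs_mult power2_eq_square algebra_simps)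
  then have "\<bar>k * s\<bar> < 1/2" by (metis abs_numeral abs_one abs_divide abs_square_less_1 power2_less_imp_less power2_abs abs_ge_zero
        zero_le_divide_1_iff zero_le_numeral)
  moreover have "\<bar>c\<bar> \<le> 1" using sc by (metis abs_square_le_1 add.commute le_add_same_cancel1 zero_le_power2)
  ultimately have "\<bar>k * s * c\<bar> < 1/2"
    using mult_left_mono[of "\<bar>c\<bar>" 1 "\<bar>k * s\<bar>"] by (simp add: abs_mult)
  moreover have "\<bar>Re (e / d)\<bar> < 1/2" using ed e1 abs_Re_le_cmod[of "e/d"] by linarith
  ultimately show False using re by linarith
qed

text \<open>Writing the difference of two points as \<open>exp w\<close> replaces the punctured
  plane by its contractible universal cover, so the difference quotient has a logarithm on the whole
  space. A full turn of \<open>w\<close> changes it by a constant winding number, which vanishes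
  because it can be computed on a large circle, where \<open>h\<close> is close to a shear. The last
  identity reflects the symmetry of the quotient in its two points.\<close>

lemma near_shear_difference_log:
  assumes "near_shear h" "continuous_on UNIV h" "inj h"
  obtains L :: "complex \<times> complex \<Rightarrow> complex" where "continuous_on UNIV L"
    "\<And>x w. exp (L (x, w)) = (h (x + exp w) - h x) / exp w"
    "\<And>x w. L (x, w + 2 * of_real pi * \<i>) = L (x, w)"
    "\<And>x w. L (x + exp w, w + of_real pi * \<i>) = L (x, w)"
proof -
  define u where "u = (\<lambda>p::complex \<times> complex. (h (fst p + exp (snd p)) - h (fst p)) / exp (snd p))"
  have contu: "continuous_on UNIV u"
    unfolding u_def by (intro continuous_intros continuous_on_compose2[OF assms(2)]) auto
  have "u p \<noteq> 0" for p
    using injD[OF assms(3), of "fst p + exp (snd p)" "fst p"] by (auto simp: u_def)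
  then obtain L where L: "continuous_on UNIV L" "\<And>p. u p = exp (L p)"
    using continuous_logarithm_on_contractible[OF contu] convex_imp_contractible[OF convex_UNIV]
    by (metis UNIV_I)
  have comp: "continuous_on UNIV (\<lambda>p. L (f p))" if "continuous_on UNIV f" for f :: "complex \<times> complex \<Rightarrow> _"
    using continuous_on_compose2[OF L(1) that] by simp
  have u2: "u (x, w + 2 * of_real pi * \<i>) = u (x, w)" for x w
    by (simp add: u_def exp_add)
  have ec: "exp (L p - L q) = 1" if "u p = u q" for p q
    using that L(2) by (simp add: exp_diff)
  obtain n where n: "\<And>p. L (fst p, snd p + 2 * of_real pi * \<i>) - L p = 2 * of_int n * of_real pi * \<i>"
  proof (rule exp_valued_1_constant[of UNIV "\<lambda>p. L (fst p, snd p + 2 * of_real pi * \<i>) - L p"])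
    show "continuous_on UNIV (\<lambda>p. L (fst p, snd p + 2 * of_real pi * \<i>) - L p)"
      by (intro continuous_intros comp L)
    show "\<And>x. exp (L (fst x, snd x + 2 * complex_of_real pi * \<i>) - L x) = 1"
      by (intro ec) (metis u2 prod.collapse)
  qed auto
  have n0: "n = 0"
  proof -
    obtain k C where kC: "\<And>z. norm (h z - (z + of_real (k * Im z))) \<le> C"
      using assms(1) by (auto simp: near_shear_def)
    \<comment> \<open>The error of \<open>h d - h 0\<close> against the shear is at most
      \<open>2 * \<bar>C\<bar>\<close>, one \<open>C\<close> from each end point.\<close>
    define r where "r = 1 + 4 * \<bar>C\<bar> + 8 * \<bar>k\<bar> * \<bar>C\<bar>"
    have r: "r > 0" "r > 2 * (2 * \<bar>C\<bar>)" "r > 4 * \<bar>k\<bar> * (2 * \<bar>C\<bar>)" 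
      by (auto simp: r_def intro!: add_pos_nonneg add_nonneg_pos add_strict_increasing)
    define w where "w = (\<lambda>t::real. of_real (ln r) + of_real t * \<i>)"
    have nw: "norm (exp (w t)) = r" for t
      using r by (simp add: w_def)
    have avoid: "u (0, w t) \<notin> \<real>\<^sub>\<le>\<^sub>0" for t
    proof -
      define d where "d = exp (w t)"
      have nd: "norm d = r" by (simp only: d_def nw)
      define e where "e = (h d - (d + of_real (k * Im d))) - (h 0 - (0 + of_real (k * Im 0)))"
      have "norm e \<le> 2 * \<bar>C\<bar>"
        using norm_triangle_ineq4[of "h d - (d + of_real (k * Im d))" "h 0 - (0 + of_real (k * Im 0))"]
          kC[of d] kC[of 0] unfolding e_def by linarith
      then have "(d + of_real (k * Im d) + e) / d \<notin> \<real>\<^sub>\<le>\<^sub>0"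
        using r nd by (intro shear_quotient_avoids_nonpos[of e "2 * \<bar>C\<bar>"]) simp_all
      also have "(d + of_real (k * Im d) + e) / d = u (0, w t)"
        by (simp add: e_def u_def d_def)
      finally show ?thesis .
    qed
    have cw: "continuous_on UNIV w" unfolding w_def by (intro continuous_intros)
    have cuw: "continuous_on UNIV (\<lambda>t. u (0, w t))"
      by (rule continuous_on_compose2[OF contu]) (auto intro!: continuous_intros cw)
    obtain m where m: "\<And>t. L (0, w t) - Ln (u (0, w t)) = 2 * of_int m * of_real pi * \<i>"
    proof (rule exp_valued_1_constant[of UNIV "\<lambda>t. L (0, w t) - Ln (u (0, w t))"])
      have "continuous_on UNIV (\<lambda>t. L (0, w t))"
        by (rule continuous_on_compose2[OF L(1)]) (auto intro!: continuous_intros cw)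
      then show "continuous_on UNIV (\<lambda>t. L (0, w t) - Ln (u (0, w t)))"
        using avoid by (intro continuous_intros cuw) auto
      show "exp (L (0, w x) - Ln (u (0, w x))) = 1" for x
        using L(2) by (metis exp_diff exp_not_eq_zero exp_Ln divide_self_if)
    qed auto
    have w2: "w (2 * pi) = w 0 + 2 * of_real pi * \<i>" by (simp add: w_def)
    have "L (0, w (2 * pi)) = L (0, w 0)"
      using m[of "2*pi"] m[of 0] u2[of 0 "w 0"] unfolding w2 by (simp add: algebra_simps)
    then show ?thesis using n[of "(0, w 0)"] w2 by auto
  qed
  have per: "L (x, w + 2 * of_real pi * \<i>) = L (x, w)" for x w
    using n[of "(x, w)"] n0 by simp
  have us: "u (x + exp w, w + of_real pi * \<i>) = u (x, w)" for x w
    by (simp add: u_def exp_add divide_simps)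
  obtain c where c: "\<And>p. L (fst p + exp (snd p), snd p + of_real pi * \<i>) - L p = 2 * of_int c * of_real pi * \<i>"
  proof (rule exp_valued_1_constant[of UNIV "\<lambda>p. L (fst p + exp (snd p), snd p + of_real pi * \<i>) - L p"])
    show "continuous_on UNIV (\<lambda>p. L (fst p + exp (snd p), snd p + of_real pi * \<i>) - L p)"
      by (intro continuous_intros comp L)
    show "\<And>x. exp (L (fst x + exp (snd x), snd x + complex_of_real pi * \<i>) - L x) = 1"
      by (intro ec) (metis us prod.collapse)
  qed auto
  \<comment> \<open>Two half turns lead back to the same pair of points with \<open>w\<close>
    increased by a full turn, so twice this defect is the defect of a full turn, which is 0.\<close>
  have "c = 0"
  proof -
    have "L (0 + exp 0 + exp (0 + of_real pi * \<i>), 0 + of_real pi * \<i> + of_real pi * \<i>) - L (0, 0)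
       = 2 * (2 * of_int c * of_real pi * \<i>)"
      using c[of "(0 + exp 0, 0 + of_real pi * \<i>)"] c[of "(0,0)"] by (simp add: algebra_simps)
    moreover have "L (0 + exp 0 + exp (0 + of_real pi * \<i>), 0 + of_real pi * \<i> + of_real pi * \<i>) = L (0,0)"
      using per[of 0 0] by (simp add: algebra_simps)
    ultimately show ?thesis by auto
  qed
  then have "L (x + exp w, w + of_real pi * \<i>) = L (x, w)" for x w
    using c[of "(x, w)"] by simp
  moreover have "exp (L (x, w)) = (h (x + exp w) - h x) / exp w" for x w
    using L(2)[of "(x, w)"] by (simp add: u_def)
  ultimately show thesis using that[of L] L(1) per by blast
qed

text \<open>Let \<open>V\<close> be a logarithm of \<open>h z - z\<close>. Both
  \<open>V (h z) - V z\<close> and \<open>L (z, V z)\<close> are logarithms of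
  \<open>(h (h z) - h z) / (h z - z)\<close>, so they differ by a constant. Comparing it at the two
  points of a 2-cycle, where the symmetry of \<open>L\<close> makes the \<open>L\<close>-terms
  equal, yields \<open>V q = V p\<close>, although the two displacements are opposite.\<close>

lemma brouwer_homeo_no_period_2:
  assumes "brouwer_homeo h"
  shows "h (h p) \<noteq> p"
proof
  assume hhp: "h (h p) = p"
  have inj: "inj h" and cont: "continuous_on UNIV h" and ns: "near_shear h" and fpf: "\<And>z. h z \<noteq> z"
    using assms brouwer_homeo_inj brouwer_homeo_cont by (auto simp: brouwer_homeo_def)
  obtain L where L: "continuous_on UNIV L"
    "\<And>x w. exp (L (x, w)) = (h (x + exp w) - h x) / exp w"
    "\<And>x w. L (x, w + 2 * of_real pi * \<i>) = L (x, w)"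
    "\<And>x w. L (x + exp w, w + of_real pi * \<i>) = L (x, w)"
    using near_shear_difference_log[OF ns cont inj] by blast
  have Lint: "L (x, w + 2 * of_int r * of_real pi * \<i>) = L (x, w)" for x w and r :: int
  proof (induction r rule: int_induct[where k = 0])
    case base then show ?case by simp
  next
    case (step1 i) then show ?case
      using L(3)[of x "w + 2 * of_int i * of_real pi * \<i>"] by (simp add: algebra_simps)
  next
    case (step2 i) then show ?case
      using L(3)[of x "w + 2 * of_int (i - 1) * of_real pi * \<i>"] by (simp add: algebra_simps)
  qed
  have "continuous_on UNIV (\<lambda>z. h z - z)" by (intro continuous_intros cont)
  then obtain V where V: "continuous_on UNIV V" "\<And>z. h z - z = exp (V z)"
    using continuous_logarithm_on_contractible[of UNIV "\<lambda>z. h z - z"]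
      convex_imp_contractible[OF convex_UNIV] fpf
    by (metis UNIV_I right_minus_eq)
  have hV: "z + exp (V z) = h z" for z using V(2)[of z] by (simp add: algebra_simps)
  obtain m where m: "\<And>z. V (h z) - V z - L (z, V z) = 2 * of_int m * of_real pi * \<i>"
  proof (rule exp_valued_1_constant[of UNIV "\<lambda>z. V (h z) - V z - L (z, V z)"])
    show "continuous_on UNIV (\<lambda>z. V (h z) - V z - L (z, V z))"
      by (intro continuous_intros continuous_on_compose2[OF V(1) cont] V(1)
          continuous_on_compose2[OF L(1)]) auto
    show "exp (V (h z) - V z - L (z, V z)) = 1" for z
      using fpf[of "h z"] V(2)[of "h z", symmetric] V(2)[of z, symmetric] fpf[of z]
      by (simp add: exp_diff L(2) hV)
  qed auto
  define q where "q = h p"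
  have e: "exp (V q) = exp (V p + of_real pi * \<i>)"
    using V(2)[of p, symmetric] V(2)[of q, symmetric] hhp by (simp add: q_def exp_add)
  then obtain r :: int where r: "V q = V p + of_real pi * \<i> + 2 * of_int r * of_real pi * \<i>"
    unfolding exp_eq by (auto simp: algebra_simps)
  have "L (q, V q) = L (p, V p)"
    unfolding r Lint using L(4)[of p "V p"] hV[of p] by (simp add: q_def)
  moreover have "V q - V p - L (p, V p) = V p - V q - L (q, V q)"
    using m[of p] m[of q] hhp by (simp add: q_def)
  ultimately have "V q = V p" by (simp add: algebra_simps)
  then have "h q - q = h p - p" using V(2) by simp
  then have "2 * (p - q) = 0" using hhp by (simp add: q_def algebra_simps)
  then show False using fpf[of p] by (simp add: q_def)
qed

lemma near_shear_inverse:
  assumes "near_shear h" "\<And>z. h (g z) = z"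
  shows "near_shear g"
proof -
  obtain k C where kC: "\<And>z. norm (h z - (z + of_real (k * Im z))) \<le> C"
    using assms(1) by (auto simp: near_shear_def)
  have "norm (g z - (z + of_real ((- k) * Im z))) \<le> C + \<bar>k\<bar> * C" for z
  proof -
    define e where "e = z - (g z + of_real (k * Im (g z)))"
    have e: "norm e \<le> C" using kC[of "g z"] by (simp add: e_def assms(2))
    have "g z - (z + of_real ((- k) * Im z)) = - e + of_real (k * Im e)"
      by (simp add: e_def algebra_simps complex_eq_iff)
    moreover have "norm (of_real (k * Im e) :: complex) \<le> \<bar>k\<bar> * C"
      using abs_Im_le_cmod[of e] e unfolding norm_of_real abs_mult
      by (intro mult_left_mono) auto
    ultimately show ?thesis
      using norm_triangle_ineq[of "- e" "of_real (k * Im e)"] e by simp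
  qed
  then show ?thesis unfolding near_shear_def by blast
qed

lemma brouwer_homeo_inverse:
  assumes "brouwer_homeo h" "homeomorphism UNIV UNIV h g"
  shows "brouwer_homeo g"
proof -
  have "h (g z) = z" for z using assms(2) by (simp add: homeomorphism_def)
  then show ?thesis
    using assms near_shear_inverse[of h g] homeomorphism_symD[OF assms(2)]
    unfolding brouwer_homeo_def by metis
qed

section \<open>Perturbations supported in free sets\<close>

definition supported_in :: "(complex \<Rightarrow> complex) \<Rightarrow> complex set \<Rightarrow> bool" where
  "supported_in r U \<longleftrightarrow> (\<exists>s. homeomorphism UNIV UNIV r s) \<and>
     bounded {z. r z \<noteq> z} \<and> {z. r z \<noteq> z} \<subseteq> U"

lemma supported_in_moving_point:
  assumes "open U" "connected U" "a \<in> U" "b \<in> U"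
  obtains r where "supported_in r U" "r a = b"
proof -
  have "affine hull U = UNIV" using affine_hull_open assms by blast
  then obtain f g where fg: "homeomorphism UNIV UNIV f g" "f a = b"
      "{x. \<not> (f x = x \<and> g x = x)} \<subseteq> U" "bounded {x. \<not> (f x = x \<and> g x = x)}"
    using homeomorphism_moving_point[of U UNIV a b] assms by auto
  have "{x. f x \<noteq> x} \<subseteq> {x. \<not> (f x = x \<and> g x = x)}" by auto
  then have "bounded {x. f x \<noteq> x}" "{x. f x \<noteq> x} \<subseteq> U"
    using fg(3,4) bounded_subset by blast+
  then show thesis using that[of f] fg by (auto simp: supported_in_def)
qed

lemma supported_in_outside: "supported_in r U \<Longrightarrow> z \<notin> U \<Longrightarrow> r z = z"
  by (auto simp: supported_in_def)

lemma supported_in_inside: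
  assumes "supported_in r U" "z \<in> U"
  shows "r z \<in> U"
proof (rule ccontr)
  assume "r z \<notin> U"
  then have "r (r z) = r z" using assms(1) supported_in_outside by blast
  moreover have "inj r"
    using assms(1) unfolding supported_in_def homeomorphism_def inj_def by (metis UNIV_I)
  ultimately show False using \<open>r z \<notin> U\<close> assms(2) by (metis injD)
qed

lemma supported_in_iff: "supported_in r U \<Longrightarrow> r z \<in> U \<longleftrightarrow> z \<in> U"
  by (metis supported_in_inside supported_in_outside)

text \<open>A point mapped into \<open>U\<close> starts outside \<open>U\<close>, and
  \<open>r\<close> keeps its image in \<open>U\<close>; all other points move as under
  \<open>h\<close>. The bounded support changes \<open>h\<close> by a bounded amount, so it stays
  near the same shear.\<close>

lemma brouwer_homeo_perturb:
  assumes "brouwer_homeo h" "supported_in r U" "\<And>z. z \<in> U \<Longrightarrow> h z \<notin> U"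
  shows "brouwer_homeo (r \<circ> h)"
proof -
  obtain g s where gs: "homeomorphism UNIV UNIV h g" "homeomorphism UNIV UNIV r s"
    using assms by (auto simp: brouwer_homeo_def supported_in_def)
  obtain k C where kC: "\<And>z. norm (h z - (z + of_real (k * Im z))) \<le> C"
    using assms(1) by (auto simp: brouwer_homeo_def near_shear_def)
  obtain B where B: "\<And>z. r z \<noteq> z \<Longrightarrow> norm z \<le> B"
    using assms(2) by (auto simp: supported_in_def bounded_iff)
  have rB: "norm (r z - z) \<le> 2 * \<bar>B\<bar>" for z
  proof (cases "r z = z")
    case False
    have "inj r"
      using gs(2) unfolding homeomorphism_def inj_def by (metis UNIV_I)
    then have "r (r z) \<noteq> r z" using False by (auto dest: injD)
    then show ?thesis
      using B[of z] B[of "r z"] False norm_triangle_ineq4[of "r z" z] by linarith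
  qed auto
  have "norm ((r \<circ> h) z - (z + of_real (k * Im z))) \<le> 2 * \<bar>B\<bar> + C" for z
    using rB[of "h z"] kC[of z] norm_diff_triangle_le[of "r (h z)" "h z" _ "z + of_real (k * Im z)"]
    by simp
  moreover have "(r \<circ> h) z \<noteq> z" for z
  proof (cases "h z \<in> U")
    case True
    then show ?thesis using assms supported_in_inside by fastforce
  next
    case False
    then show ?thesis using assms by (simp add: supported_in_outside brouwer_homeo_def)
  qed
  moreover have "homeomorphism UNIV UNIV (r \<circ> h) (g \<circ> s)"
    using homeomorphism_compose[OF gs] .
  ultimately show ?thesis
    unfolding brouwer_homeo_def near_shear_def by blast
qed

lemma ball_neighbourhood_connected:
  fixes K :: "complex set"
  assumes "connected K" "K \<noteq> {}" "e > 0"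
  shows "connected (\<Union>x\<in>K. ball x e)"
proof -
  have "(\<Union>x\<in>K. ball x e) = (\<lambda>p. fst p + snd p) ` (K \<times> ball 0 e)"
  proof safe
    fix x y assume "x \<in> K" "y \<in> ball x e"
    then show "y \<in> (\<lambda>p. fst p + snd p) ` (K \<times> ball 0 e)"
      by (intro image_eqI[of _ _ "(x, y - x)"]) (auto simp: dist_norm norm_minus_commute)
  next
    fix x y assume "x \<in> K" "y \<in> ball (0::complex) e"
    then show "fst (x, y) + snd (x, y) \<in> (\<Union>x\<in>K. ball x e)"
      by (intro UN_I[of x]) (auto simp: dist_norm)
  qed
  moreover have "connected ((\<lambda>p. fst p + snd p) ` (K \<times> ball 0 e))"
    by (intro connected_continuous_image continuous_intros connected_Times assms connected_ball)
  ultimately show ?thesis by simp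
qed

text \<open>\<open>K\<close> and its image have disjoint neighbourhoods, and a uniform ball
  neighbourhood of a connected set is connected. The obstacle \<open>C\<close> serves to make the
  neighbourhood of a path compatible with a ball at its end.\<close>

lemma compact_connected_free_neighbourhood:
  fixes h :: "complex \<Rightarrow> complex"
  assumes "compact K" "connected K" "K \<noteq> {}" "continuous_on UNIV h" "h ` K \<inter> K = {}"
    and "closed C" "C \<inter> K = {}"
  obtains W where "open W" "connected W" "K \<subseteq> W" "h ` W \<inter> W = {}" "C \<inter> W = {}"
proof -
  have "compact (h ` K)" using assms compact_continuous_image continuous_on_subset by blast
  then obtain A B where AB: "open A" "open B" "K \<subseteq> A" "h ` K \<subseteq> B" "A \<inter> B = {}"
    using separation_normal[of K "h ` K"] assms by (metis compact_imp_closed inf_commute)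
  define O' where "O' = A \<inter> h -` B \<inter> - C"
  have "open O'" using AB assms unfolding O'_def
    by (intro open_Int open_vimage open_Compl) auto
  moreover have "K \<subseteq> O'" using AB assms unfolding O'_def by auto
  ultimately obtain e where e: "e > 0" "(\<Union>x\<in>K. ball x e) \<subseteq> O'"
    using compact_subset_open_imp_ball_epsilon_subset assms(1) by metis
  show thesis
  proof (rule that[of "\<Union>x\<in>K. ball x e"])
    show "connected (\<Union>x\<in>K. ball x e)" by (rule ball_neighbourhood_connected[OF assms(2,3) e(1)])
    have "h z \<in> B" "z \<in> A" if "z \<in> (\<Union>x\<in>K. ball x e)" for z
      using e(2) that unfolding O'_def by blast+
    then show "h ` (\<Union>x\<in>K. ball x e) \<inter> (\<Union>x\<in>K. ball x e) = {}"
      using AB(5) by blast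
    show "C \<inter> (\<Union>x\<in>K. ball x e) = {}" using e(2) unfolding O'_def by blast
    show "K \<subseteq> (\<Union>x\<in>K. ball x e)" using e(1) by (meson UN_I centre_in_ball subsetI)
  qed (simp add: open_UN)
qed

section \<open>Connected free open sets never return\<close>

text \<open>The quantifier over \<open>h\<close> belongs to the property because shortening a period
  replaces the map; general free sets instead of points are needed to control neighbourhoods of
  paths.\<close>

definition no_return :: "nat \<Rightarrow> bool" where
  "no_return n \<longleftrightarrow> (\<forall>h U. brouwer_homeo h \<and> open U \<and> connected U \<and> h ` U \<inter> U = {} \<longrightarrow>
     (h ^^ n) ` U \<inter> U = {})"

lemma no_returnD:
  assumes "no_return n" "brouwer_homeo h" "open U" "connected U" "h ` U \<inter> U = {}" "z \<in> U"
  shows "(h ^^ n) z \<notin> U"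
  using assms unfolding no_return_def by blast

lemma brouwer_homeo_free_ball:
  assumes "brouwer_homeo h"
  obtains e where "e > 0" "h ` ball z e \<inter> ball z e = {}"
proof -
  have "h ` {z} \<inter> {z} = {}" using assms by (auto simp: brouwer_homeo_def)
  then obtain W where "open W" "connected W" "{z} \<subseteq> W" "h ` W \<inter> W = {}"
    using compact_connected_free_neighbourhood[of "{z}" h "{}"]
      brouwer_homeo_cont[OF assms] by auto
  then obtain e where "e > 0" "ball z e \<subseteq> W" using open_contains_ball by blast
  then show thesis using that[of e] \<open>h ` W \<inter> W = {}\<close> by blast
qed

lemma no_return_imp_not_periodic:
  assumes "no_return n" "brouwer_homeo h"
  shows "(h ^^ n) z \<noteq> z"
proof -
  obtain e where "e > 0" "h ` ball z e \<inter> ball z e = {}"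
    using brouwer_homeo_free_ball[OF assms(2)] by blast
  then show ?thesis
    using no_returnD[OF assms(1,2), of "ball z e" z] by auto
qed

text \<open>Follow a path from \<open>x\<close> to \<open>h x\<close> up to the first parameter \<open>t\<close> at which it meets its own
  image.  Either the end point \<open>\<gamma> t\<close> is the image of an earlier point or the other way round; the
  two cases are exchanged by passing to the inverse of \<open>h\<close>.\<close>

lemma first_touching_path:
  assumes "brouwer_homeo h"
  obtains \<gamma> :: "real \<Rightarrow> complex" and s t :: real where "continuous_on {0..1} \<gamma>" "\<gamma> 0 = x"
    "0 \<le> s" "s < t" "t \<le> 1" "\<And>t'. 0 \<le> t' \<Longrightarrow> t' < t \<Longrightarrow> h ` \<gamma> ` {0..t'} \<inter> \<gamma> ` {0..t'} = {}"
    "\<gamma> t = h (\<gamma> s) \<or> h (\<gamma> t) = \<gamma> s"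
proof -
  define \<gamma> where "\<gamma> = linepath x (h x)"
  have c\<gamma>: "continuous_on A \<gamma>" for A unfolding \<gamma>_def by (rule continuous_on_linepath)
  have ch: "continuous_on A h" for A by (rule brouwer_homeo_cont[OF assms])
  have fpf: "h z \<noteq> z" for z using assms by (auto simp: brouwer_homeo_def)
  \<comment> \<open>Pairs of parameters at which the path meets its image. Minimising the larger
    parameter over this compact set, which contains \<open>(1, 0)\<close>, gives the first touching
    time.\<close>
  define P where "P = ({0..1} \<times> {0..1}) \<inter> (\<lambda>p. \<gamma> (fst p) - h (\<gamma> (snd p))) -` {0::complex}"
  have "continuous_on ({0..1} \<times> {0..1}) (\<lambda>p. \<gamma> (fst p) - h (\<gamma> (snd p)))"
    by (intro continuous_intros continuous_on_compose2[OF c\<gamma>[of UNIV]]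
        continuous_on_compose2[OF ch[of UNIV]]) auto
  then have "closed P"
    unfolding P_def by (intro continuous_closed_preimage closed_Times) auto
  then have "compact P"
    using compact_Int_closed[of "{0..1::real} \<times> {0..1::real}" P] compact_Times[of "{0..1::real}" "{0..1::real}"]
    by (simp add: P_def Int_absorb1 inf_commute)
  moreover have "(1, 0) \<in> P" by (simp add: P_def \<gamma>_def linepath_def)
  moreover have "continuous_on P (\<lambda>p. max (fst p) (snd p))"
    by (intro continuous_intros)
  ultimately obtain p where p: "p \<in> P" "\<And>q. q \<in> P \<Longrightarrow> max (fst p) (snd p) \<le> max (fst q) (snd q)"
    using continuous_attains_inf[of P "\<lambda>p. max (fst p) (snd p)"] by blast
  define t where "t = max (fst p) (snd p)"
  define s where "s = min (fst p) (snd p)"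
  have pp: "\<gamma> (fst p) = h (\<gamma> (snd p))" "0 \<le> fst p" "fst p \<le> 1" "0 \<le> snd p" "snd p \<le> 1"
    using p(1) by (auto simp: P_def)
  have "fst p \<noteq> snd p" using pp fpf by metis
  moreover have "h ` \<gamma> ` {0..t'} \<inter> \<gamma> ` {0..t'} = {}" if t': "0 \<le> t'" "t' < t" for t'
  proof (rule ccontr)
    assume "h ` \<gamma> ` {0..t'} \<inter> \<gamma> ` {0..t'} \<noteq> {}"
    then obtain z where "z \<in> h ` \<gamma> ` {0..t'}" "z \<in> \<gamma> ` {0..t'}" by blast
    then obtain a b where ab: "a \<in> {0..t'}" "b \<in> {0..t'}" "h (\<gamma> b) = \<gamma> a" by force
    moreover have "t \<le> 1" using pp by (auto simp: t_def)
    ultimately have "(a, b) \<in> P" using t' by (auto simp: P_def)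
    then show False using p(2)[of "(a,b)"] ab t' by (auto simp: t_def)
  qed
  moreover have "\<gamma> t = h (\<gamma> s) \<or> h (\<gamma> t) = \<gamma> s"
    using pp(1) by (cases "fst p \<le> snd p") (auto simp: s_def t_def max_def min_def)
  moreover have "\<gamma> 0 = x" by (simp add: \<gamma>_def linepath_def)
  moreover have "0 \<le> s" "t \<le> 1" using pp by (auto simp: s_def t_def)
  moreover have "s < t" using \<open>fst p \<noteq> snd p\<close> by (auto simp: s_def t_def)
  ultimately show thesis
    using that[of \<gamma> s t] c\<gamma> by blast
qed

text \<open>With \<open>W\<close> a free neighbourhood of \<open>\<gamma> ` {0..t'}\<close> for \<open>t'\<close> slightly less than \<open>t\<close>, and \<open>B\<close> a small ball
  at the touching point \<open>\<gamma> t\<close>, the preimage of \<open>B\<close> is a bridge from the preimage of \<open>W\<close> to \<open>W\<close>.  Pushing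
  \<open>(h ^^ (n - 1)) x\<close> across it to \<open>x\<close> saves one iterate.\<close>

lemma shorten_period:
  fixes s t :: real
  assumes h: "brouwer_homeo h" and n: "n \<ge> 3" and per: "(h ^^ n) x = x"
    and nr: "\<And>m. 1 \<le> m \<Longrightarrow> m < n \<Longrightarrow> no_return m"
    and \<gamma>: "continuous_on {0..1} \<gamma>" "\<gamma> 0 = x"
    and st: "0 \<le> s" "s < t" "t \<le> 1"
    and free: "\<And>t'. 0 \<le> t' \<Longrightarrow> t' < t \<Longrightarrow> h ` \<gamma> ` {0..t'} \<inter> \<gamma> ` {0..t'} = {}"
    and touch: "\<gamma> t = h (\<gamma> s)"
  obtains h' where "brouwer_homeo h'" "(h' ^^ (n - 1)) x = x"
proof -
  have ch: "continuous_on A h" for A by (rule brouwer_homeo_cont[OF h])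
  have inj: "inj h" by (rule brouwer_homeo_inj[OF h])
  have fpf: "h z \<noteq> z" for z using h by (auto simp: brouwer_homeo_def)
  obtain g where hg: "homeomorphism UNIV UNIV h g" using h by (auto simp: brouwer_homeo_def)
  then have hgz: "h (g z) = z" "g (h z) = z" and cg: "continuous_on UNIV g" for z
    by (auto simp: homeomorphism_def)
  have vim: "g ` A = h -` A" for A
  proof safe
    fix y assume "h y \<in> A"
    then show "y \<in> g ` A" using hgz(2)[of y] by (metis imageI)
  qed (simp add: hgz)
  have cK: "compact (\<gamma> ` {0..t'})" "connected (\<gamma> ` {0..t'})" "\<gamma> ` {0..t'} \<noteq> {}" if "0 \<le> t'" "t' \<le> t" for t'
    using that st by (auto intro!: compact_continuous_image connected_continuous_image
        continuous_on_subset[OF \<gamma>(1)])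
  \<comment> \<open>A piece of the path before time \<open>t\<close> is compact, connected and free,
    so it has a connected free open neighbourhood, to which \<open>nr\<close> applies.\<close>
  have nrK: "(h ^^ m) (\<gamma> u) \<noteq> \<gamma> v" if "1 \<le> m" "m < n" "0 \<le> u" "u < t" "0 \<le> v" "v < t" for m u v
  proof -
    have "0 \<le> max u v" "max u v < t" using that by auto
    then obtain W where "open W" "connected W" "\<gamma> ` {0..max u v} \<subseteq> W" "h ` W \<inter> W = {}"
      using compact_connected_free_neighbourhood[of "\<gamma> ` {0..max u v}" h "{}"] cK[of "max u v"]
        free[of "max u v"] ch by auto
    moreover have "\<gamma> u \<in> \<gamma> ` {0..max u v}" "\<gamma> v \<in> \<gamma> ` {0..max u v}" using that by auto
    ultimately show ?thesis
      using no_returnD[OF nr h] that by (metis subsetD)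
  qed
  \<comment> \<open>As \<open>\<gamma> t = h (\<gamma> s)\<close>, such a meeting would be a return
    of \<open>\<gamma> s\<close> after two steps, excluded because \<open>2 < n\<close>.\<close>
  have 1: "h (\<gamma> t) \<notin> \<gamma> ` {0..t}"
  proof
    assume "h (\<gamma> t) \<in> \<gamma> ` {0..t}"
    then obtain u where u: "0 \<le> u" "u \<le> t" "h (\<gamma> t) = \<gamma> u" by auto
    then have "u < t" using fpf[of "\<gamma> t"] by (cases "u = t") auto
    then show False
      using nrK[of 2 s u] u st n touch by (simp add: numeral_2_eq_2)
  qed
  have 2: "\<gamma> t \<notin> (h ^^ 2) ` \<gamma> ` {0..t}"
  proof
    assume "\<gamma> t \<in> (h ^^ 2) ` \<gamma> ` {0..t}"
    then obtain u where u: "0 \<le> u" "u \<le> t" "\<gamma> t = h (h (\<gamma> u))" by (auto simp: numeral_2_eq_2)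
    then have us: "\<gamma> s = h (\<gamma> u)" using touch inj by (auto dest: injD)
    then have "u \<noteq> t" using 1 st by force
    then show False using nrK[of 1 u s] us u st n by auto
  qed
  have 3: "\<gamma> t \<noteq> (h ^^ m) x" if m: "2 \<le> m" "m < n" for m
  proof
    assume "\<gamma> t = (h ^^ m) x"
    also have "\<dots> = h ((h ^^ (m - 1)) x)" using m by (cases m) auto
    finally have "\<gamma> s = (h ^^ (m - 1)) x" using touch inj by (auto dest: injD)
    moreover have "1 \<le> m - 1" "m - 1 < n" using m by auto
    ultimately show False using nrK[of "m - 1" 0 s] st \<gamma>(2) by auto
  qed
  have c2: "continuous_on A (h ^^ 2)" for A
    unfolding numeral_2_eq_2 by (auto intro!: continuous_on_compose2[OF ch[of UNIV]] ch)
  obtain e0 where e0: "e0 > 0" "h ` ball (\<gamma> t) e0 \<inter> ball (\<gamma> t) e0 = {}"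
    using brouwer_homeo_free_ball[OF h] by blast
  have cpt: "compact (\<gamma> ` {0..t})" "compact ((h ^^ 2) ` \<gamma> ` {0..t})"
    using cK(1)[of t] st by (auto intro!: compact_continuous_image c2)
  \<comment> \<open>The factors serve, in order, the freeness of \<open>B\<close>, the disjointness
    of \<open>C\<close> and \<open>K\<close> (the next two), and the fact that the orbit of
    \<open>x\<close> avoids \<open>B\<close> at the times 2 to \<open>n - 1\<close>.\<close>
  define O' where "O' = ball (\<gamma> t) e0 \<inter> - (h ^^ 2) ` \<gamma> ` {0..t} \<inter> h -` (- \<gamma> ` {0..t}) \<inter>
    - (\<lambda>m. (h ^^ m) x) ` {2..<n}"
  have "open O'" unfolding O'_def
    using cpt by (intro open_Int open_Compl open_vimage ch open_ball finite_imp_closed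
        compact_imp_closed) auto
  have "\<gamma> t \<notin> (\<lambda>m. (h ^^ m) x) ` {2..<n}"
  proof
    assume "\<gamma> t \<in> (\<lambda>m. (h ^^ m) x) ` {2..<n}"
    then obtain m where "m \<in> {2..<n}" "\<gamma> t = (h ^^ m) x" by blast
    with 3[of m] show False by auto
  qed
  then have "\<gamma> t \<in> O'" using 1 2 e0(1) by (simp add: O'_def)
  with \<open>open O'\<close> obtain e where e: "e > 0" "cball (\<gamma> t) e \<subseteq> O'"
    using open_contains_cball by blast
  define B where "B = ball (\<gamma> t) e"
  have BO: "B \<subseteq> cball (\<gamma> t) e" by (auto simp: B_def)
  have Bfree: "h z \<notin> B" if "z \<in> B" for z
    using e0(2) e(2) BO that by (auto simp: O'_def)
  have tB: "\<gamma> t \<in> B" using e by (simp add: B_def)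
  obtain d where d: "d > 0" "\<And>u. 0 \<le> u \<Longrightarrow> u \<le> 1 \<Longrightarrow> dist u t < d \<Longrightarrow> \<gamma> u \<in> B"
  proof -
    have "t \<in> {0..1}" using st by auto
    with \<gamma>(1) e(1) obtain d where "d > 0" "\<forall>u\<in>{0..1}. dist u t < d \<longrightarrow> dist (\<gamma> u) (\<gamma> t) < e"
      unfolding continuous_on_iff by blast
    then show thesis using that[of d] by (auto simp: B_def dist_commute)
  qed
  \<comment> \<open>Late enough for \<open>\<gamma> t'\<close> to lie in \<open>B\<close> and for
    \<open>\<gamma> s\<close> to lie on \<open>K\<close>, yet before the path touches its
    image.\<close>
  define t' where "t' = max ((s + t) / 2) (t - d / 2)"
  have t': "s < t'" "t' < t" "dist t' t < d"
    using st d(1) by (auto simp: t'_def dist_real_def max_def field_simps)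
  have t'B: "\<gamma> t' \<in> B" using d(2)[of t'] t' st by auto
  define K where "K = \<gamma> ` {0..t'}"
  have Kt: "K \<subseteq> \<gamma> ` {0..t}" using t' by (auto simp: K_def)
  \<comment> \<open>Keeping \<open>W\<close> off \<open>C\<close> means that \<open>h\<close> maps
    no point of \<open>B\<close> into \<open>W\<close>, and \<open>h ^^ 2\<close> no point of
    \<open>W\<close> into \<open>B\<close>.\<close>
  define C where "C = h ` cball (\<gamma> t) e \<union> (h ^^ 2) -` cball (\<gamma> t) e"
  have "closed C" unfolding C_def
    by (intro closed_Un compact_imp_closed compact_continuous_image ch compact_cball
        closed_vimage c2 closed_cball)
  moreover have "C \<inter> K = {}"
    using e(2) Kt unfolding C_def O'_def by fastforce
  ultimately obtain W where W: "open W" "connected W" "K \<subseteq> W" "h ` W \<inter> W = {}" "C \<inter> W = {}"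
    using compact_connected_free_neighbourhood[of K h C] cK[of t'] free[of t'] t' st ch
    by (auto simp: K_def)
  have nrW: "(h ^^ m) z \<notin> W" if "1 \<le> m" "m < n" "z \<in> W" for m z
    using no_returnD[OF nr h W(1,2,4)] that by blast
  have W1: "h z \<notin> W" if "z \<in> W" for z using W(4) that by auto
  have W2: "h (h z) \<notin> W" if "z \<in> W" for z using nrW[of 2 z] that n by (simp add: numeral_2_eq_2)
  have inW: "x \<in> W" "\<gamma> s \<in> W" "\<gamma> t' \<in> W"
    using W(3) t' st \<gamma>(2) by (auto simp: K_def image_subset_iff)
  have BW: "h z \<notin> W" if "z \<in> B" for z using W(5) BO that by (auto simp: C_def)
  have WB: "h (h z) \<notin> B" if "z \<in> W" for z
  proof -
    have "z \<notin> C" using W(5) that by blast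
    then show ?thesis using BO by (auto simp: C_def numeral_2_eq_2)
  qed
  have hx: "h ((h ^^ (n - 1)) x) = x" using per n by (cases n) auto
  have cog: "connected (g ` A)" if "connected A" for A
    using that cg by (meson connected_continuous_image continuous_on_subset subset_UNIV)
  have opg: "open (g ` A)" if "open A" for A
    unfolding vim using that by (intro open_vimage ch)
  have ing: "z \<in> g ` A \<longleftrightarrow> h z \<in> A" for z A
    unfolding vim by simp
  have "(h ^^ (n - 1)) x \<in> g ` W" "g (\<gamma> t') \<in> g ` W"
    using inW by (simp_all only: ing hx hgz)
  then obtain r1 where r1: "supported_in r1 (g ` W)" "r1 ((h ^^ (n - 1)) x) = g (\<gamma> t')"
    using supported_in_moving_point[OF opg[OF W(1)] cog[OF W(2)]] by blast
  have "open B" "connected B" by (auto simp: B_def)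
  moreover have "g (\<gamma> t') \<in> g ` B" "\<gamma> s \<in> g ` B"
    using t'B tB by (simp_all add: ing hgz touch)
  ultimately obtain r2 where r2: "supported_in r2 (g ` B)" "r2 (g (\<gamma> t')) = \<gamma> s"
    using supported_in_moving_point[OF opg cog] by blast
  obtain r3 where r3: "supported_in r3 W" "r3 (\<gamma> s) = x"
    using supported_in_moving_point W inW by blast
  have o1: "r1 z = z" if "h z \<notin> W" for z
    using supported_in_outside[OF r1(1)] that by (auto simp: ing)
  have o2: "r2 z = z" if "h z \<notin> B" for z
    using supported_in_outside[OF r2(1)] that by (auto simp: ing)
  have o3: "r3 z = z" if "z \<notin> W" for z
    using supported_in_outside[OF r3(1)] that by auto
  \<comment> \<open>Each support must be free for the map modified so far. This reduces to
    statements about \<open>h\<close>, because the earlier perturbations fix the images in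
    question.\<close>
  have "brouwer_homeo (r1 \<circ> h)"
    by (rule brouwer_homeo_perturb[OF h r1(1)]) (simp add: ing W1)
  then have "brouwer_homeo (r2 \<circ> (r1 \<circ> h))"
    by (rule brouwer_homeo_perturb[OF _ r2(1)]) (simp add: ing Bfree BW o1)
  then have "brouwer_homeo (r3 \<circ> (r2 \<circ> (r1 \<circ> h)))"
    by (rule brouwer_homeo_perturb[OF _ r3(1)]) (simp add: W1 W2 WB o1 o2)
  moreover define h' where "h' = r3 \<circ> (r2 \<circ> (r1 \<circ> h))"
  \<comment> \<open>The orbit of \<open>x\<close> feels none of the perturbations before its last
    step, where \<open>r1\<close>, \<open>r2\<close>, \<open>r3\<close> carry
    \<open>(h ^^ (n - 1)) x\<close> to \<open>g (\<gamma> t')\<close>, then to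
    \<open>\<gamma> s\<close>, then to \<open>x\<close>.\<close>
  have "(h' ^^ i) x = (h ^^ i) x" if "i \<le> n - 2" for i
    using that
  proof (induction i)
    case (Suc i)
    define y where "y = (h ^^ i) x"
    have y: "(h ^^ (i + 2)) x = h (h y)" "(h ^^ (i + 1)) x = h y" by (simp_all add: y_def)
    have "(h ^^ (i + 2)) x \<notin> W" "(h ^^ (i + 1)) x \<notin> W"
      using nrW[of "i + 2" x] nrW[of "i + 1" x] Suc.prems n inW by auto
    moreover have "(h ^^ (i + 2)) x \<notin> B"
    proof
      assume "(h ^^ (i + 2)) x \<in> B"
      then have "(h ^^ (i + 2)) x \<notin> (\<lambda>m. (h ^^ m) x) ` {2..<n}"
        using e(2) BO unfolding O'_def by blast
      then show False using Suc.prems n by (auto simp del: funpow.simps)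
    qed
    ultimately have "h (h y) \<notin> W" "h y \<notin> W" "h (h y) \<notin> B" unfolding y by auto
    then have "h' y = h y" unfolding h'_def by (simp add: o1 o2 o3)
    moreover have "(h' ^^ i) x = y" using Suc by (simp add: y_def)
    ultimately show ?case by (simp add: y_def)
  qed simp
  from this[of "n - 2"] have it: "(h' ^^ (n - 2)) x = (h ^^ (n - 2)) x" by simp
  have n1: "n - 1 = Suc (n - 2)" using n by auto
  have "(h' ^^ (n - 1)) x = h' ((h ^^ (n - 2)) x)" unfolding n1 by (simp add: it)
  moreover have "h ((h ^^ (n - 2)) x) = (h ^^ (n - 1)) x" unfolding n1 by simp
  ultimately show thesis using that[of h'] r1 r2 r3 by (simp add: h'_def)
qed

text \<open>A perturbation inside \<open>U\<close> closes a return up to a periodic orbit. Period 2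
  is excluded by the winding argument; a longer period can be lowered to \<open>n - 1\<close>, where
  the induction hypothesis forbids it.\<close>

theorem brouwer_homeo_no_return:
  assumes "n \<ge> 1"
  shows "no_return n"
  using assms
proof (induction n rule: less_induct)
  case (less n)
  have nr: "no_return m" if "1 \<le> m" "m < n" for m using less.IH that by blast
  show ?case
    unfolding no_return_def
  proof (intro allI impI, elim conjE)
    fix h U assume h: "brouwer_homeo h" and U: "open U" "connected U" "h ` U \<inter> U = {}"
    have hU: "h z \<notin> U" if "z \<in> U" for z using U(3) that by blast
    show "(h ^^ n) ` U \<inter> U = {}"
    proof (rule ccontr)
      assume "(h ^^ n) ` U \<inter> U \<noteq> {}"
      then obtain x where x: "x \<in> U" "(h ^^ n) x \<in> U" by blast
      have n2: "n \<ge> 2" using x less.prems hU[of x] by (cases "n = 1") auto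
      obtain r where r: "supported_in r U" "r ((h ^^ n) x) = x"
        using supported_in_moving_point[OF U(1,2) x(2,1)] by blast
      define f where "f = r \<circ> h"
      have f: "brouwer_homeo f"
        unfolding f_def by (rule brouwer_homeo_perturb[OF h r(1) hU])
      \<comment> \<open>By the induction hypothesis the intermediate iterates are outside
        \<open>U\<close>, so the perturbation acts only at the last step.\<close>
      have "(f ^^ i) x = (h ^^ i) x" if "i < n" for i
        using that
      proof (induction i)
        case (Suc i)
        have "(h ^^ Suc i) x \<notin> U"
          using no_returnD[OF nr h U, of "Suc i" x] x(1) Suc.prems by simp
        then show ?case using Suc by (simp add: f_def supported_in_outside[OF r(1)])
      qed simp
      from this[of "n - 1"] have "(f ^^ n) x = f ((h ^^ (n - 1)) x)"
        using n2 by (cases n) auto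
      also have "\<dots> = x" using r(2) n2 by (cases n) (auto simp: f_def)
      finally have per: "(f ^^ n) x = x" .
      have n3: "n \<ge> 3"
      proof (rule ccontr)
        assume "\<not> n \<ge> 3"
        then have "n = 2" using n2 by simp
        then show False using per brouwer_homeo_no_period_2[OF f, of x] by (simp add: numeral_2_eq_2)
      qed
      have contra: False if k: "brouwer_homeo k" "(k ^^ (n - 1)) x = x" for k
        using no_return_imp_not_periodic[OF nr k(1)] k(2) n3 by force
      obtain \<gamma> and s t :: real where \<gamma>: "continuous_on {0..1} \<gamma>" "\<gamma> 0 = x"
        "0 \<le> s" "s < t" "t \<le> 1" "\<And>t'. 0 \<le> t' \<Longrightarrow> t' < t \<Longrightarrow> f ` \<gamma> ` {0..t'} \<inter> \<gamma> ` {0..t'} = {}"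
        "\<gamma> t = f (\<gamma> s) \<or> f (\<gamma> t) = \<gamma> s"
        using first_touching_path[OF f, of x] by blast
      from \<gamma>(7) show False
      proof
        assume touch: "\<gamma> t = f (\<gamma> s)"
        obtain k where "brouwer_homeo k" "(k ^^ (n - 1)) x = x"
          by (rule shorten_period[OF f n3 per nr \<gamma>(1-6) touch])
        then show False by (rule contra)
      next
        assume touch: "f (\<gamma> t) = \<gamma> s"
        obtain g where g: "homeomorphism UNIV UNIV f g" using f by (auto simp: brouwer_homeo_def)
        then have fg: "f (g z) = z" "g (f z) = z" for z by (auto simp: homeomorphism_def)
        have "(g ^^ i) ((f ^^ i) z) = z" for i z
          by (induction i arbitrary: z) (simp_all add: fg funpow_swap1)
        then have gper: "(g ^^ n) x = x" using per by metis
        have gfree: "g ` \<gamma> ` {0..t'} \<inter> \<gamma> ` {0..t'} = {}" if "0 \<le> t'" "t' < t" for t'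
        proof -
          have "False" if "y \<in> \<gamma> ` {0..t'}" "g y \<in> \<gamma> ` {0..t'}" for y
          proof -
            have "f (g y) \<in> f ` \<gamma> ` {0..t'}" using that(2) by (rule imageI)
            then show False using \<gamma>(6)[OF \<open>0 \<le> t'\<close> \<open>t' < t\<close>] that(1) fg(1)[of y] by auto
          qed
          then show ?thesis by blast
        qed
        have gtouch: "\<gamma> t = g (\<gamma> s)" using touch fg by metis
        obtain k where "brouwer_homeo k" "(k ^^ (n - 1)) x = x"
          by (rule shorten_period[OF brouwer_homeo_inverse[OF f g] n3 gper nr \<gamma>(1-5) gfree gtouch])
        then show False by (rule contra)
      qed
    qed
  qed
qed

corollary brouwer_homeo_not_periodic:
  "brouwer_homeo h \<Longrightarrow> n \<ge> 1 \<Longrightarrow> (h ^^ n) z \<noteq> z"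
  using no_return_imp_not_periodic brouwer_homeo_no_return by blast

section \<open>Closed pseudo-orbits with jumps in free sets\<close>

text \<open>Equality is included so that genuine orbit steps count wherever they land; for disjoint
  pieces the relation is then an equivalence.\<close>

definition same_piece :: "'a set set \<Rightarrow> 'a \<Rightarrow> 'a \<Rightarrow> bool" where
  "same_piece \<E> a b \<longleftrightarrow> a = b \<or> (\<exists>E\<in>\<E>. a \<in> E \<and> b \<in> E)"

lemma same_piece_refl [simp]: "same_piece \<E> a a"
  by (simp add: same_piece_def)

lemma same_piece_sym: "same_piece \<E> a b \<Longrightarrow> same_piece \<E> b a"
  unfolding same_piece_def by blast

lemma same_piece_trans:
  assumes "disjoint \<E>" "same_piece \<E> a b" "same_piece \<E> b c"
  shows "same_piece \<E> a c"
  using assms unfolding same_piece_def disjoint_def by blast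

text \<open>In a shortest closed pseudo-orbit no two points share a piece, so each jump can be
  absorbed by a perturbation inside its piece without disturbing the other steps. Once all jumps are
  absorbed, a periodic orbit of a Brouwer homeomorphism remains. The outer induction is on the
  length, the inner one on the number of jumps.\<close>

theorem brouwer_homeo_no_closed_pseudo_orbit:
  assumes "disjoint \<E>" "\<And>E. E \<in> \<E> \<Longrightarrow> open E \<and> connected E"
    and "brouwer_homeo h" "\<And>E z. E \<in> \<E> \<Longrightarrow> z \<in> E \<Longrightarrow> h z \<notin> E"
    and "t \<ge> 1" "\<And>i. i < t \<Longrightarrow> same_piece \<E> (h (x i)) (x (Suc i))" "x t = x 0"
  shows False
  using assms(3-)
proof (induction t arbitrary: h x rule: less_induct)
  case (less t)
  \<comment> \<open>Two points in one piece cut out a shorter closed pseudo-orbit. The pair of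
    indices \<open>0\<close> and \<open>t\<close> is excluded, as it would give back the full
    length.\<close>
  have distinct: False if ij: "i < j" "j \<le> t" "j < t \<or> i > 0"
    and sp: "same_piece \<E> (x j) (x i)"
    and f: "brouwer_homeo f" "\<And>E z. E \<in> \<E> \<Longrightarrow> z \<in> E \<Longrightarrow> f z \<notin> E"
      "\<And>i. i < t \<Longrightarrow> same_piece \<E> (f (x i)) (x (Suc i))" for i j f
  proof (rule less.IH)
    show "j - i < t" "1 \<le> j - i" using ij by auto
    define y where "y = (\<lambda>m. if m = j - i then x i else x (i + m))"
    show "y (j - i) = y 0" using ij by (auto simp: y_def)
    show "same_piece \<E> (f (y m)) (y (Suc m))" if m: "m < j - i" for m
    proof (cases "Suc m = j - i")
      case True
      then have "same_piece \<E> (f (x (i + m))) (x j)" "y m = x (i + m)" "y (Suc m) = x i"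
        using f(3)[of "i + m"] ij m by (auto simp: y_def simp flip: add_Suc_right)
      then show ?thesis using same_piece_trans[OF assms(1) _ sp] by simp
    next
      case False
      then show ?thesis using f(3)[of "i + m"] ij m by (auto simp: y_def)
    qed
  qed (use f in auto)
  have "False" if "card {i. i < t \<and> f (x i) \<noteq> x (Suc i)} = N"
    "brouwer_homeo f" "\<And>E z. E \<in> \<E> \<Longrightarrow> z \<in> E \<Longrightarrow> f z \<notin> E"
      "\<And>i. i < t \<Longrightarrow> same_piece \<E> (f (x i)) (x (Suc i))" for f N
    using that
  proof (induction N arbitrary: f rule: less_induct)
    case (less N)
    note f = less.prems
    show False
    proof (cases "{i. i < t \<and> f (x i) \<noteq> x (Suc i)} = {}")
      case True
      have "x i = (f ^^ i) (x 0)" if "i \<le> t" for i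
        using that True by (induction i) (auto simp: Suc_le_eq)
      then have "(f ^^ t) (x 0) = x 0" using \<open>x t = x 0\<close> by (metis order_refl)
      then show False using brouwer_homeo_not_periodic[OF f(2) \<open>1 \<le> t\<close>] by blast
    next
      case False
      then obtain i where i: "i < t" "f (x i) \<noteq> x (Suc i)" by blast
      then obtain E where E: "E \<in> \<E>" "f (x i) \<in> E" "x (Suc i) \<in> E"
        using f(4)[OF i(1)] by (auto simp: same_piece_def)
      obtain r where r: "supported_in r E" "r (f (x i)) = x (Suc i)"
        using supported_in_moving_point[of E] E assms(2)[OF E(1)] by blast
      \<comment> \<open>No other step lands in \<open>E\<close>, so \<open>r\<close> alters only the
        step \<open>i\<close>.\<close>
      have other: "f (x j) \<notin> E" if j: "j < t" "j \<noteq> i" for j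
      proof
        assume "f (x j) \<in> E"
        then have a: "same_piece \<E> (x (Suc i)) (f (x j))" using E by (auto simp: same_piece_def)
        have sp2: "same_piece \<E> (x (Suc i)) (x (Suc j))"
          using same_piece_trans[OF assms(1) a f(4)[OF j(1)]] .
        note sp = same_piece_sym[OF sp2] sp2
        show False
        proof (cases "i < j")
          case True
          then show False using distinct[OF _ _ _ sp(1) f(2-4)] j by simp
        next
          case False
          then show False using distinct[OF _ _ _ sp(2) f(2-4)] i j by simp
        qed
      qed
      have rf: "(r \<circ> f) (x j) = (if j = i then x (Suc i) else f (x j))" if "j < t" for j
        using other[of j] that r supported_in_outside[OF r(1)] by auto
      have "{j. j < t \<and> (r \<circ> f) (x j) \<noteq> x (Suc j)} \<subset> {j. j < t \<and> f (x j) \<noteq> x (Suc j)}"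
      proof (rule psubsetI)
        show "{j. j < t \<and> (r \<circ> f) (x j) \<noteq> x (Suc j)} \<subseteq> {j. j < t \<and> f (x j) \<noteq> x (Suc j)}"
        proof (rule subsetI, unfold mem_Collect_eq, elim conjE, rule conjI)
          fix j assume j: "j < t" "(r \<circ> f) (x j) \<noteq> x (Suc j)"
          show "j < t" by (rule j(1))
          show "f (x j) \<noteq> x (Suc j)"
            using j(2) unfolding rf[OF j(1)] by (cases "j = i") simp_all
        qed
        have "(r \<circ> f) (x i) = x (Suc i)" using rf[OF i(1)] by (simp only: if_True simp_thms)
        then show "{j. j < t \<and> (r \<circ> f) (x j) \<noteq> x (Suc j)} \<noteq> {j. j < t \<and> f (x j) \<noteq> x (Suc j)}"
          using i by blast
      qed
      then have "card {j. j < t \<and> (r \<circ> f) (x j) \<noteq> x (Suc j)} < N"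
        unfolding f(1)[symmetric] by (intro psubset_card_mono) auto
      then show False
      proof (rule less.IH[OF _ refl])
        show "brouwer_homeo (r \<circ> f)"
          by (rule brouwer_homeo_perturb[OF f(2) r(1)]) (use f(3) E in blast)
        \<comment> \<open>\<open>r\<close> preserves \<open>E\<close> and fixes every other piece
          pointwise, so all pieces stay free.\<close>
        show "(r \<circ> f) z \<notin> E'" if E': "E' \<in> \<E>" "z \<in> E'" for E' z
        proof (cases "E' = E")
          case True
          then show ?thesis using f(3) E' supported_in_iff[OF r(1)] by simp
        next
          case False
          then have "E' \<inter> E = {}" using assms(1) E(1) E' by (auto simp: disjoint_def)
          moreover have "f z \<notin> E'" using f(3) E' by blast
          ultimately show ?thesis
            using supported_in_iff[OF r(1), of "f z"] supported_in_outside[OF r(1), of "f z"]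
            by (cases "f z \<in> E") auto
        qed
        show "same_piece \<E> ((r \<circ> f) (x j)) (x (Suc j))" if "j < t" for j
          unfolding rf[OF that] using f(4)[OF that] by (cases "j = i") simp_all
      qed
    qed
  qed
  from this[OF refl less.prems(1-2) less.prems(4)] show False by blast
qed

section \<open>Minimal twist maps of the plane\<close>

definition lattice_pt :: "int \<Rightarrow> int \<Rightarrow> complex" where
  "lattice_pt a b = Complex (of_int a) (of_int b)"

lemma lattice_pt_sel [simp]: "Re (lattice_pt a b) = of_int a" "Im (lattice_pt a b) = of_int b"
  by (simp_all add: lattice_pt_def)

lemma lattice_pt_add: "lattice_pt a b + lattice_pt a' b' = lattice_pt (a + a') (b + b')"
  by (simp add: complex_eq_iff)

lemma lattice_pt_0 [simp]: "lattice_pt 0 0 = 0"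
  by (simp add: complex_eq_iff)

lemma lattice_decompose:
  obtains w a b where "w \<in> cbox 0 (Complex 1 1)" "z = w + lattice_pt a b"
proof (rule that)
  show "z = (z - lattice_pt \<lfloor>Re z\<rfloor> \<lfloor>Im z\<rfloor>) + lattice_pt \<lfloor>Re z\<rfloor> \<lfloor>Im z\<rfloor>" by simp
  show "z - lattice_pt \<lfloor>Re z\<rfloor> \<lfloor>Im z\<rfloor> \<in> cbox 0 (Complex 1 1)"
    by (simp add: in_cbox_complex_iff) linarith
qed

lemma lattice_norm_ge_1:
  assumes "lattice_pt a b \<noteq> 0"
  shows "1 \<le> norm (lattice_pt a b)"
proof -
  have "a \<noteq> 0 \<or> b \<noteq> 0" using assms by (auto simp: complex_eq_iff)
  then have "1 \<le> \<bar>real_of_int a\<bar> \<or> 1 \<le> \<bar>real_of_int b\<bar>" by linarith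
  then show ?thesis
    using abs_Re_le_cmod[of "lattice_pt a b"] abs_Im_le_cmod[of "lattice_pt a b"] by auto
qed

lemma periodic_continuous_bounded:
  fixes \<phi> :: "complex \<Rightarrow> 'a::real_normed_vector"
  assumes "continuous_on UNIV \<phi>" "\<And>z a b. \<phi> (z + lattice_pt a b) = \<phi> z"
  obtains C where "C \<ge> 0" "\<And>z. norm (\<phi> z) \<le> C"
proof -
  have "compact (\<phi> ` cbox 0 (Complex 1 1))"
    by (intro compact_continuous_image compact_cbox continuous_on_subset[OF assms(1)]) auto
  then have "bounded (\<phi> ` cbox 0 (Complex 1 1))" by (rule compact_imp_bounded)
  then obtain C where C: "\<And>w. w \<in> cbox 0 (Complex 1 1) \<Longrightarrow> norm (\<phi> w) \<le> C"
    unfolding bounded_iff by blast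
  have "norm (\<phi> z) \<le> C" for z
  proof -
    obtain w a b where "w \<in> cbox 0 (Complex 1 1)" "z = w + lattice_pt a b"
      by (rule lattice_decompose)
    then show ?thesis using C assms(2) by simp
  qed
  moreover from this[of 0] have "0 \<le> C" by (rule order_trans[OF norm_ge_zero])
  ultimately show thesis using that by blast
qed

lemma periodic_open_cover_uniform:
  fixes P :: "nat \<Rightarrow> complex \<Rightarrow> bool"
  assumes "\<And>n. open {z. P n z}" "\<And>z. \<exists>n. P n z" "\<And>n z a b. P n z \<Longrightarrow> P n (z + lattice_pt a b)"
  obtains N where "\<And>z. \<exists>n\<le>N. P n z"
proof -
  have "cbox 0 (Complex 1 1) \<subseteq> (\<Union>n\<in>UNIV. {z. P n z})" using assms(2) by auto
  then obtain T where T: "finite T" "cbox 0 (Complex 1 1) \<subseteq> (\<Union>n\<in>T. {z. P n z})"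
    using compactE_image[OF compact_cbox, of UNIV "\<lambda>n. {z. P n z}"] assms(1) by (metis subset_UNIV)
  have "\<exists>n\<le>Max T. P n z" for z
  proof (rule lattice_decompose[of z])
    fix w a b assume w: "w \<in> cbox 0 (Complex 1 1)" "z = w + lattice_pt a b"
    then obtain n where "n \<in> T" "P n w" using T by blast
    then show ?thesis using assms(3)[of n w] w T(1) by (auto intro!: exI[of _ n])
  qed
  then show thesis using that by blast
qed

text \<open>Lattice-invariant closed sets are the preimages of closed sets of the torus, so the last
  assumption is minimality downstairs, in its forward form. A locale is used because the results are
  needed again for powers of \<open>G\<close> combined with translations.\<close>

locale minimal_twist =
  fixes G :: "complex \<Rightarrow> complex" and k :: int
  assumes homeo: "\<exists>g. homeomorphism UNIV UNIV G g"
    and G_add: "G (z + lattice_pt a b) = G z + lattice_pt (a + k * b) b"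
    and k_nonzero: "k \<noteq> 0"
    and minimal: "closed S \<Longrightarrow> S \<noteq> {} \<Longrightarrow> (\<And>z a b. z \<in> S \<Longrightarrow> z + lattice_pt a b \<in> S) \<Longrightarrow>
      (\<And>z. z \<in> S \<Longrightarrow> G z \<in> S) \<Longrightarrow> S = UNIV"
begin

lemma cont: "continuous_on A G"
  using homeo unfolding homeomorphism_def by (meson continuous_on_subset subset_UNIV)

lemma cont_iter: "continuous_on A (G ^^ n)"
proof (induction n arbitrary: A)
  case (Suc n)
  then show ?case by (auto intro!: continuous_on_compose2[OF cont[of UNIV]])
qed simp

lemma iter_add: "(G ^^ n) (z + lattice_pt a b) = (G ^^ n) z + lattice_pt (a + k * b * int n) b"
  by (induction n) (simp_all add: G_add algebra_simps)

lemma displacement_bounded: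
  obtains d where "d \<ge> 0" "\<And>z n. \<bar>Im ((G ^^ n) z) - Im z\<bar> \<le> real n * d"
proof -
  have "continuous_on UNIV (\<lambda>z. Im (G z) - Im z)" by (intro continuous_intros cont)
  then obtain d where d: "d \<ge> 0" "\<And>z. \<bar>Im (G z) - Im z\<bar> \<le> d"
    using periodic_continuous_bounded[of "\<lambda>z. Im (G z) - Im z"] by (auto simp: G_add)
  have "\<bar>Im ((G ^^ n) z) - Im z\<bar> \<le> real n * d" for z n
  proof (induction n)
    case (Suc n)
    then show ?case using d(2)[of "(G ^^ n) z"] by (simp add: algebra_simps)
  qed simp
  then show thesis using that d by blast
qed

lemma near_shear: "near_shear G"
proof -
  define \<phi> where "\<phi> = (\<lambda>z. G z - (z + of_real (of_int k * Im z)))"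
  have "continuous_on UNIV \<phi>" unfolding \<phi>_def by (intro continuous_intros cont)
  moreover have "\<phi> (z + lattice_pt a b) = \<phi> z" for z a b
    by (simp add: \<phi>_def G_add complex_eq_iff algebra_simps)
  ultimately obtain C where "\<And>z. norm (\<phi> z) \<le> C"
    using periodic_continuous_bounded by metis
  then show ?thesis unfolding near_shear_def \<phi>_def by blast
qed

text \<open>Otherwise the lattice coset of \<open>z\<close> would be a closed invariant set, and it
  misses the point at horizontal distance 1/2 from \<open>z\<close>.\<close>

lemma no_fixed_point: "G z \<noteq> z + lattice_pt a b"
proof
  assume fixed: "G z = z + lattice_pt a b"
  define S where "S = {w. Re (w - z) \<in> \<int> \<and> Im (w - z) \<in> \<int>}"
  have Siff: "w \<in> S \<longleftrightarrow> (\<exists>a b. w = z + lattice_pt a b)" for w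
    by (auto simp: S_def Ints_def complex_eq_iff algebra_simps)
  have "S = (\<lambda>w. Re (w - z)) -` \<int> \<inter> (\<lambda>w. Im (w - z)) -` \<int>" by (auto simp: S_def)
  also have "closed \<dots>"
    by (intro closed_Int closed_vimage continuous_intros closed_Ints)
  finally have "closed S" .
  moreover have "S \<noteq> {}" using Siff by blast
  moreover have "w + lattice_pt a b \<in> S" if "w \<in> S" for w a b
    using that unfolding Siff by (metis add.assoc lattice_pt_add)
  moreover have "G w \<in> S" if "w \<in> S" for w
    using that unfolding Siff by (metis add.assoc lattice_pt_add G_add fixed)
  ultimately have "S = UNIV" by (rule minimal)
  then have "z + Complex (1/2) 0 \<in> S" by simp
  then have "(1/2 :: real) \<in> \<int>" by (simp add: S_def)
  then obtain x where "(1/2 :: real) = of_int x" by (auto elim: Ints_cases)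
  then have "real_of_int (2 * x) = 1" by simp
  then have "2 * x = 1" by linarith
  then show False by presburger
qed

lemma brouwer_homeo_translate: "brouwer_homeo (\<lambda>z. G z - of_int j)"
proof -
  obtain g where "homeomorphism UNIV UNIV G g" using homeo by blast
  moreover have "homeomorphism UNIV UNIV (\<lambda>z. z - of_int j) (\<lambda>z. z + of_int j :: complex)"
    by (auto simp: homeomorphism_def surj_def image_iff intro!: continuous_intros)
  ultimately have "homeomorphism UNIV UNIV ((\<lambda>z. z - of_int j) \<circ> G) (g \<circ> (\<lambda>z. z + of_int j))"
    by (rule homeomorphism_compose)
  moreover obtain \<kappa> C where C: "\<And>z. norm (G z - (z + of_real (\<kappa> * Im z))) \<le> C"
    using near_shear by (auto simp: near_shear_def)
  have "norm ((G z - of_int j) - (z + of_real (\<kappa> * Im z))) \<le> C + norm (of_int j :: complex)" for z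
    using norm_triangle_ineq4[of "G z - (z + of_real (\<kappa> * Im z))" "of_int j"] C[of z]
    by (simp add: algebra_simps)
  then have "near_shear (\<lambda>z. G z - of_int j)" unfolding near_shear_def by blast
  moreover have "G z - of_int j \<noteq> z" for z
    using no_fixed_point[of z j 0] by (auto simp: complex_eq_iff algebra_simps)
  ultimately show ?thesis unfolding brouwer_homeo_def comp_def by blast
qed

text \<open>The points where the cardinality is at least that at a given point form a closed
  invariant set, so the cardinality is constant. The inclusions near each point are then equalities,
  and a locally constant map on the plane is constant. Periodicity and invariance concern only
  cardinalities, since in the applications the sets themselves get shifted.\<close>

lemma upper_semicontinuous_imp_constant:
  fixes J :: "complex \<Rightarrow> int set"
  assumes fin: "\<And>z. finite (J z)"
    and usc: "\<And>z. \<exists>U. open U \<and> z \<in> U \<and> (\<forall>w\<in>U. J w \<subseteq> J z)"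
    and per: "\<And>z a b. card (J (z + lattice_pt a b)) = card (J z)"
    and inv: "\<And>z. card (J z) \<le> card (J (G z))"
  shows "J z = J w"
proof -
  have ge: "card (J w) \<ge> card (J z)" for z w
  proof -
    define S where "S = {w. card (J w) \<ge> card (J z)}"
    have "open (- S)"
    proof (subst open_subopen, intro ballI)
      fix v assume v: "v \<in> - S"
      obtain U where U: "open U" "v \<in> U" "\<forall>w\<in>U. J w \<subseteq> J v" using usc by blast
      have "U \<subseteq> - S"
      proof
        fix w assume "w \<in> U"
        then have "card (J w) \<le> card (J v)" using U(3) fin card_mono by blast
        then show "w \<in> - S" using v by (simp add: S_def)
      qed
      then show "\<exists>T. open T \<and> v \<in> T \<and> T \<subseteq> - S" using U by blast
    qed
    then have "closed S" by (simp add: closed_def)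
    moreover have "z \<in> S" by (simp add: S_def)
    then have "S \<noteq> {}" by blast
    moreover have "v + lattice_pt a b \<in> S" if "v \<in> S" for v a b
      using that by (simp add: S_def per)
    moreover have "G v \<in> S" if "v \<in> S" for v
      using that inv[of v] by (simp add: S_def)
    ultimately have "S = UNIV" by (rule minimal)
    then show ?thesis by (auto simp: S_def)
  qed
  have "eventually (\<lambda>w. J v = J w) (at v within UNIV)" for v
  proof -
    obtain U where U: "open U" "v \<in> U" "\<forall>w\<in>U. J w \<subseteq> J v" using usc by blast
    have "J v = J w" if "w \<in> U" for w
      using card_subset_eq[OF fin, of "J w" v] U(3) ge[of v w] ge[of w v] that by simp
    then show ?thesis using U unfolding eventually_at_topological by blast
  qed
  then show ?thesis
    using connected_local_const[of UNIV z w J] by auto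
qed

text \<open>By semicontinuity the set of levels \<open>m\<close> at which a vertical translate of \<open>z\<close> meets the closure
  \<open>\<Omega>\<close> of a bounded orbit cannot depend on \<open>z\<close>, but it is finite and moves when \<open>z\<close> is translated.\<close>

lemma no_bounded_orbit: "\<not> (\<forall>n. \<bar>Im ((G ^^ n) w) - Im w\<bar> \<le> C)"
proof
  assume bdd: "\<forall>n. \<bar>Im ((G ^^ n) w) - Im w\<bar> \<le> C"
  \<comment> \<open>Only horizontal translates are added: this keeps the heights bounded, and it
    absorbs the horizontal shift that \<open>G\<close> makes out of a vertical one.\<close>
  define Q where "Q = {(G ^^ n) w + lattice_pt a 0 | n a. True}"
  define \<Omega> where "\<Omega> = closure Q"
  have \<Omega>_Im: "\<bar>Im z - Im w\<bar> \<le> C" if "z \<in> \<Omega>" for z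
  proof -
    have "closed {z. \<bar>Im z - Im w\<bar> \<le> C}"
      by (intro closed_Collect_le continuous_intros)
    moreover have "Q \<subseteq> {z. \<bar>Im z - Im w\<bar> \<le> C}" using bdd by (auto simp: Q_def)
    ultimately show ?thesis using closure_minimal that unfolding \<Omega>_def by blast
  qed
  have \<Omega>_add: "z + lattice_pt a 0 \<in> \<Omega>" if "z \<in> \<Omega>" for z a
  proof -
    have "(\<lambda>z. z + lattice_pt a 0) ` closure Q \<subseteq> closure ((\<lambda>z. z + lattice_pt a 0) ` Q)"
      by (rule image_closure_subset) (auto intro!: continuous_intros closure_subset)
    also have "\<dots> \<subseteq> closure Q"
    proof (rule closure_mono, safe)
      fix z assume "z \<in> Q"
      then obtain n a' where "z = (G ^^ n) w + lattice_pt a' 0" by (auto simp: Q_def)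
      then have "z + lattice_pt a 0 = (G ^^ n) w + lattice_pt (a' + a) 0"
        by (simp add: lattice_pt_add add.assoc)
      then show "z + lattice_pt a 0 \<in> Q" unfolding Q_def by blast
    qed
    finally show ?thesis using that by (auto simp: \<Omega>_def)
  qed
  have \<Omega>_G: "G z \<in> \<Omega>" if "z \<in> \<Omega>" for z
  proof -
    have "G ` closure Q \<subseteq> closure (G ` Q)"
      by (rule image_closure_subset) (auto intro!: cont closure_subset)
    also have "\<dots> \<subseteq> closure Q"
    proof (rule closure_mono, safe)
      fix z assume "z \<in> Q"
      then obtain n a where "z = (G ^^ n) w + lattice_pt a 0" by (auto simp: Q_def)
      then have "G z = (G ^^ Suc n) w + lattice_pt a 0" by (simp add: G_add)
      then show "G z \<in> Q" unfolding Q_def by blast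
    qed
    finally show ?thesis using that by (auto simp: \<Omega>_def)
  qed
  define J where "J = (\<lambda>z. {m::int. z + lattice_pt 0 m \<in> \<Omega>})"
  have J_sub: "J z \<subseteq> {- \<lceil>C + \<bar>Im w\<bar> + \<bar>Im v\<bar> + 1\<rceil> .. \<lceil>C + \<bar>Im w\<bar> + \<bar>Im v\<bar> + 1\<rceil>}" if "dist v z < 1" for v z
  proof
    fix m assume "m \<in> J z"
    then have "\<bar>Im z + of_int m - Im w\<bar> \<le> C" using \<Omega>_Im by (force simp: J_def)
    moreover have "\<bar>Im v - Im z\<bar> < 1"
      using that abs_Im_le_cmod[of "v - z"] by (simp add: dist_norm)
    ultimately have "\<bar>real_of_int m\<bar> \<le> C + \<bar>Im w\<bar> + \<bar>Im v\<bar> + 1" by linarith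
    then show "m \<in> {- \<lceil>C + \<bar>Im w\<bar> + \<bar>Im v\<bar> + 1\<rceil> .. \<lceil>C + \<bar>Im w\<bar> + \<bar>Im v\<bar> + 1\<rceil>}"
      by (simp add: abs_le_iff) linarith
  qed
  have fin: "finite (J z)" for z
    by (rule finite_subset[OF J_sub[of z z]]) auto
  have usc: "\<exists>U. open U \<and> z \<in> U \<and> (\<forall>w\<in>U. J w \<subseteq> J z)" for z
  proof -
    define M where "M = {- \<lceil>C + \<bar>Im w\<bar> + \<bar>Im z\<bar> + 1\<rceil> .. \<lceil>C + \<bar>Im w\<bar> + \<bar>Im z\<bar> + 1\<rceil>} - J z"
    define U where "U = ball z 1 \<inter> (\<Inter>m\<in>M. (\<lambda>v. v + lattice_pt 0 m) -` (- \<Omega>))"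
    have "open U" unfolding U_def M_def \<Omega>_def
      by (intro open_Int open_ball open_INT ballI open_vimage continuous_intros open_Compl
          closed_closure finite_Diff finite_atLeastAtMost_int)
    moreover have "z \<in> U" by (auto simp: U_def M_def J_def)
    moreover have "J v \<subseteq> J z" if "v \<in> U" for v
      using J_sub[of z v] that by (force simp: U_def M_def J_def)
    ultimately show ?thesis by blast
  qed
  have J_add: "m \<in> J (z + lattice_pt a b) \<longleftrightarrow> m + b \<in> J z" for m z a b
  proof -
    have "z + lattice_pt a b + lattice_pt 0 m = z + lattice_pt 0 (m + b) + lattice_pt a 0"
      "z + lattice_pt 0 (m + b) = z + lattice_pt a b + lattice_pt 0 m + lattice_pt (- a) 0"
      by (simp_all add: complex_eq_iff)
    then show ?thesis unfolding J_def mem_Collect_eq using \<Omega>_add by metis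
  qed
  have J_image: "J (z + lattice_pt a b) = (\<lambda>m. m - b) ` J z" for z a b
  proof safe
    fix m assume "m \<in> J (z + lattice_pt a b)"
    then show "m \<in> (\<lambda>m. m - b) ` J z" by (intro image_eqI[of _ _ "m + b"]) (simp_all add: J_add)
  qed (simp add: J_add)
  have inv: "J z \<subseteq> J (G z)" for z
  proof
    fix m assume "m \<in> J z"
    then have "G (z + lattice_pt 0 m) \<in> \<Omega>" by (auto simp: J_def intro: \<Omega>_G)
    then have "G (z + lattice_pt 0 m) + lattice_pt (- (k * m)) 0 \<in> \<Omega>" by (rule \<Omega>_add)
    then show "m \<in> J (G z)" by (simp add: J_def G_add add.assoc lattice_pt_add)
  qed
  have "J z = J (z + lattice_pt 0 1)" for z
    by (rule upper_semicontinuous_imp_constant[OF fin usc _ card_mono[OF fin inv]])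
      (simp add: J_image card_image inj_on_def)
  then have shift: "m \<in> J w \<longleftrightarrow> m + 1 \<in> J w" for m using J_add[of m w 0 1] by simp
  have "w \<in> Q" unfolding Q_def by (auto intro!: exI[of _ 0])
  then have "w \<in> \<Omega>" using closure_subset unfolding \<Omega>_def by blast
  then have "0 \<in> J w" by (simp add: J_def)
  then have "J w \<noteq> {}" by blast
  then have "Max (J w) \<in> J w" using fin by simp
  then have "Max (J w) + 1 \<in> J w" using shift by simp
  then show False using Max_ge[OF fin, of "Max (J w) + 1" w] by simp
qed

section \<open>Pseudo-orbits through discs at lattice points\<close>

definition pieces :: "real \<Rightarrow> complex set set" where
  "pieces e = {ball (lattice_pt a b) e | a b. True}"

text \<open>Pseudo-orbits of length \<open>n\<close> from the disc at \<open>0\<close> to its translate by \<open>(a, b)\<close>.  The triples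
  \<open>(n, a, b)\<close> compose like elements of a Heisenberg group because \<open>G\<close> twists translations.\<close>

definition chain :: "real \<Rightarrow> nat \<Rightarrow> int \<Rightarrow> int \<Rightarrow> bool" where
  "chain e n a b \<longleftrightarrow> (\<exists>x. x 0 \<in> ball 0 e \<and> x n \<in> ball (lattice_pt a b) e \<and>
     (\<forall>i<n. same_piece (pieces e) (G (x i)) (x (Suc i))))"

lemma ball_in_pieces: "z \<in> ball (lattice_pt a b) e \<Longrightarrow> \<exists>E\<in>pieces e. z \<in> E"
  unfolding pieces_def by (intro bexI[of _ "ball (lattice_pt a b) e"]) blast+

lemma in_piecesE:
  assumes "\<exists>E\<in>pieces e. z \<in> E"
  obtains a b where "z \<in> ball (lattice_pt a b) e"
proof -
  obtain E where "E \<in> pieces e" "z \<in> E" using assms by blast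
  then show thesis using that unfolding pieces_def by blast
qed

lemma same_piece_ball:
  assumes "z \<in> ball (lattice_pt a b) e" "w \<in> ball (lattice_pt a b) e"
  shows "same_piece (pieces e) z w"
proof -
  have "ball (lattice_pt a b) e \<in> pieces e" by (auto simp: pieces_def)
  then show ?thesis using assms unfolding same_piece_def by blast
qed

lemma disjoint_pieces:
  assumes "e \<le> 1/2"
  shows "disjoint (pieces e)"
proof (rule disjointI)
  fix A B assume AB: "A \<in> pieces e" "B \<in> pieces e" "A \<noteq> B"
  then obtain a b a' b' where ab: "A = ball (lattice_pt a b) e" "B = ball (lattice_pt a' b') e"
    by (auto simp: pieces_def)
  then have "lattice_pt a b - lattice_pt a' b' \<noteq> 0" using AB(3) by auto
  then have "lattice_pt (a - a') (b - b') \<noteq> 0" by (simp add: complex_eq_iff)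
  then have "1 \<le> norm (lattice_pt (a - a') (b - b'))" by (rule lattice_norm_ge_1)
  also have "lattice_pt (a - a') (b - b') = lattice_pt a b - lattice_pt a' b'"
    by (simp add: complex_eq_iff)
  finally have "1 \<le> dist (lattice_pt a b) (lattice_pt a' b')" by (simp add: dist_norm)
  then show "A \<inter> B = {}" unfolding ab using assms by (intro disjoint_ballI) linarith
qed

lemma mem_ball_lattice: "z + lattice_pt a b \<in> ball (w + lattice_pt a b) e \<longleftrightarrow> z \<in> ball w e"
  by (simp add: dist_norm)

lemma same_piece_add:
  assumes "same_piece (pieces e) z w"
  shows "same_piece (pieces e) (z + lattice_pt a b) (w + lattice_pt a b)"
proof (cases "z = w")
  case False
  then obtain a' b' where "z \<in> ball (lattice_pt a' b') e" "w \<in> ball (lattice_pt a' b') e"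
    using assms unfolding same_piece_def pieces_def by blast
  then have "z + lattice_pt a b \<in> ball (lattice_pt (a' + a) (b' + b)) e"
    "w + lattice_pt a b \<in> ball (lattice_pt (a' + a) (b' + b)) e"
    unfolding lattice_pt_add[symmetric] mem_ball_lattice by auto
  then show ?thesis by (rule same_piece_ball)
qed simp

text \<open>The second chain is moved to the end of the first, by \<open>(a, b)\<close>; after
  \<open>i\<close> further steps the twist has turned this translation into
  \<open>(a + k * b * int i, b)\<close>.\<close>

lemma chain_trans:
  assumes e: "e \<le> 1/2" and "chain e n a b" "chain e m c d"
  shows "chain e (n + m) (a + c + k * b * int m) (b + d)"
proof -
  obtain x where x: "x 0 \<in> ball 0 e" "x n \<in> ball (lattice_pt a b) e"
    "\<And>i. i < n \<Longrightarrow> same_piece (pieces e) (G (x i)) (x (Suc i))"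
    using assms(2) unfolding chain_def by blast
  obtain y where y: "y 0 \<in> ball 0 e" "y m \<in> ball (lattice_pt c d) e"
    "\<And>i. i < m \<Longrightarrow> same_piece (pieces e) (G (y i)) (y (Suc i))"
    using assms(3) unfolding chain_def by blast
  define u where "u = (\<lambda>i. y i + lattice_pt (a + k * b * int i) b)"
  have u0: "same_piece (pieces e) (x n) (u 0)"
  proof -
    have "u 0 \<in> ball (lattice_pt a b) e"
      using y(1) mem_ball_lattice[of "y 0" a b 0 e] by (simp add: u_def)
    with x(2) show ?thesis by (rule same_piece_ball)
  qed
  have u_step: "same_piece (pieces e) (G (u i)) (u (Suc i))" if "i < m" for i
  proof -
    have "G (u i) = G (y i) + lattice_pt (a + k * b * int (Suc i)) b"
      by (simp add: u_def G_add algebra_simps)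
    then show ?thesis using same_piece_add[OF y(3)[OF that]] by (simp add: u_def)
  qed
  define z where "z = (\<lambda>i. if i < n then x i else u (i - n))"
  have "z 0 \<in> ball 0 e"
  proof (cases "n = 0")
    \<comment> \<open>The joined sequence now starts in the second chain; a first chain of length 0
      stays in one disc, which forces \<open>a = 0\<close> and \<open>b = 0\<close>.\<close>
    case True
    then have "lattice_pt a b = 0"
    proof -
      have "norm (lattice_pt a b) < 2 * e"
        using x(1,2) True norm_triangle_ineq4[of "lattice_pt a b - x 0" "- x 0"]
        by (simp add: dist_norm)
      then show ?thesis using lattice_norm_ge_1[of a b] e by linarith
    qed
    then have "a = 0" "b = 0" by (auto simp: complex_eq_iff)
    then show ?thesis using True y(1) by (simp add: z_def u_def)
  qed (use x(1) in \<open>simp add: z_def\<close>)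
  moreover have "z (n + m) \<in> ball (lattice_pt (a + c + k * b * int m) (b + d)) e"
  proof -
    have "lattice_pt (a + c + k * b * int m) (b + d) = lattice_pt c d + lattice_pt (a + k * b * int m) b"
      by (simp add: complex_eq_iff)
    then show ?thesis using y(2) by (simp only: z_def u_def mem_ball_lattice) simp
  qed
  moreover have "same_piece (pieces e) (G (z i)) (z (Suc i))" if i: "i < n + m" for i
  proof -
    consider "Suc i < n" | "Suc i = n" | "i \<ge> n" by linarith
    then show ?thesis
    proof cases
      case 1
      then show ?thesis using x(3)[of i] by (simp add: z_def)
    next
      case 2
      then have "same_piece (pieces e) (G (x i)) (x n)" using x(3)[of i] by auto
      then show ?thesis using same_piece_trans[OF disjoint_pieces[OF e] _ u0] 2 by (auto simp: z_def)
    next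
      case 3
      then show ?thesis using u_step[of "i - n"] i by (simp add: z_def Suc_diff_le)
    qed
  qed
  ultimately show ?thesis unfolding chain_def by blast
qed

text \<open>For \<open>b = 0\<close> no twist accumulates, so the horizontal displacement of the
  power is known exactly.\<close>

lemma chain_power:
  assumes "e > 0" "e \<le> 1/2" "chain e n a b"
  obtains a' where "chain e (l * n) a' (int l * b)" "b = 0 \<Longrightarrow> a' = int l * a"
proof -
  have "\<exists>a'. chain e (l * n) a' (int l * b) \<and> (b = 0 \<longrightarrow> a' = int l * a)"
  proof (induction l)
    case 0
    have "chain e 0 0 0" using assms(1) unfolding chain_def by (intro exI[of _ "\<lambda>_. 0"]) simp
    then show ?case by auto
  next
    case (Suc l)
    then obtain a' where a': "chain e (l * n) a' (int l * b)" "b = 0 \<longrightarrow> a' = int l * a" by blast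
    have "chain e (n + l * n) (a + a' + k * b * int (l * n)) (b + int l * b)"
      by (rule chain_trans[OF assms(2,3) a'(1)])
    then show ?case
      using a'(2) by (intro exI[of _ "a + a' + k * b * int (l * n)"]) (auto simp: algebra_simps)
  qed
  then show thesis using that by blast
qed

text \<open>Freeness is asked against all pieces, not only the disc itself, so that it persists for
  \<open>G\<close> followed by the translation by \<open>- j\<close>.\<close>

lemma no_closed_chain:
  assumes e: "e \<le> 1/2" and free: "\<And>E z. E \<in> pieces e \<Longrightarrow> z \<in> ball 0 e \<Longrightarrow> G z \<notin> E"
    and "n \<ge> 1"
  shows "\<not> chain e n (j * int n) 0"
proof
  assume "chain e n (j * int n) 0"
  then obtain x where x: "x 0 \<in> ball 0 e" "x n \<in> ball (lattice_pt (j * int n) 0) e"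
    "\<And>i. i < n \<Longrightarrow> same_piece (pieces e) (G (x i)) (x (Suc i))"
    unfolding chain_def by blast
  \<comment> \<open>Horizontal translations commute with \<open>G\<close>, so subtracting
    \<open>j\<close> per step gives a pseudo-orbit of \<open>z \<mapsto> G z - j\<close>. Its last
    point lies in the same disc as \<open>x 0\<close> and is replaced by it.\<close>
  define y where "y = (\<lambda>i. if i < n then x i + lattice_pt (- (j * int i)) 0 else x 0)"
  have xn: "same_piece (pieces e) (x n + lattice_pt (- (j * int n)) 0) (x 0)"
  proof -
    have "x n + lattice_pt (- (j * int n)) 0 \<in> ball (lattice_pt 0 0) e"
      using x(2) mem_ball_lattice[of "x n" "- (j * int n)" 0 "lattice_pt (j * int n) 0" e]
      by (simp add: lattice_pt_add)
    moreover have "x 0 \<in> ball (lattice_pt 0 0) e" using x(1) by simp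
    ultimately show ?thesis by (rule same_piece_ball)
  qed
  have step: "same_piece (pieces e) (G (y i) - of_int j) (y (Suc i))" if i: "i < n" for i
  proof -
    have "G (y i) - of_int j = G (x i) + lattice_pt (- (j * int (Suc i))) 0"
      using i by (simp add: y_def G_add complex_eq_iff algebra_simps)
    moreover have "same_piece (pieces e) \<dots> (x (Suc i) + lattice_pt (- (j * int (Suc i))) 0)"
      by (rule same_piece_add[OF x(3)[OF i]])
    ultimately have 1: "same_piece (pieces e) (G (y i) - of_int j) (x (Suc i) + lattice_pt (- (j * int (Suc i))) 0)"
      by simp
    show ?thesis
    proof (cases "Suc i = n")
      case True
      then show ?thesis
        using same_piece_trans[OF disjoint_pieces[OF e] 1] xn by (simp add: y_def)
    next
      case False
      then show ?thesis using 1 i by (simp add: y_def)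
    qed
  qed
  have free': "G z - of_int j \<notin> E" if "E \<in> pieces e" "z \<in> E" for E z
  proof
    assume "G z - of_int j \<in> E"
    obtain a b where E: "E = ball (lattice_pt a b) e" using \<open>E \<in> pieces e\<close> by (auto simp: pieces_def)
    define w where "w = z + lattice_pt (- a) (- b)"
    have "w \<in> ball 0 e"
      using that(2) mem_ball_lattice[of z "- a" "- b" "lattice_pt a b" e] unfolding E w_def
      by (simp add: lattice_pt_add)
    moreover have "G w = (G z - of_int j) + lattice_pt (j - a - k * b) (- b)"
      by (simp add: w_def G_add complex_eq_iff algebra_simps)
    then have "G w \<in> ball (lattice_pt a b + lattice_pt (j - a - k * b) (- b)) e"
      using \<open>G z - of_int j \<in> E\<close> unfolding E by (simp only: mem_ball_lattice)
    then have "\<exists>E\<in>pieces e. G w \<in> E" unfolding lattice_pt_add by (rule ball_in_pieces)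
    ultimately show False using free by blast
  qed
  show False
  proof (rule brouwer_homeo_no_closed_pseudo_orbit[where \<E> = "pieces e" and x = y and t = n])
    show "disjoint (pieces e)" by (rule disjoint_pieces[OF e])
    show "open E \<and> connected E" if "E \<in> pieces e" for E using that by (auto simp: pieces_def)
    show "brouwer_homeo (\<lambda>z. G z - of_int j)" by (rule brouwer_homeo_translate)
    show "y n = y 0" using \<open>n \<ge> 1\<close> by (simp add: y_def)
  qed (use free' step \<open>n \<ge> 1\<close> in auto)
qed

lemma no_opposite_chains:
  assumes e: "e > 0" "e \<le> 1/2" and free: "\<And>E z. E \<in> pieces e \<Longrightarrow> z \<in> ball 0 e \<Longrightarrow> G z \<notin> E"
    and "chain e n a b" "chain e m c d" "n \<ge> 1" "m \<ge> 1" "b > 0" "d < 0"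
  shows False
proof -
  \<comment> \<open>Repeating the chains \<open>- d\<close> and \<open>b\<close> times makes them
    climb and descend by the same height \<open>B = - d * b\<close>.\<close>
  obtain a1 where a1: "chain e (nat (- d) * n) a1 (int (nat (- d)) * b)"
    using chain_power[OF e assms(4)] by metis
  obtain a2 where a2: "chain e (nat b * m) a2 (int (nat b) * d)"
    using chain_power[OF e assms(5)] by metis
  define N1 N2 B where "N1 = nat (- d) * n" and "N2 = nat b * m" and "B = - d * b"
  define M where "M = N1 + N2"
  define p q where "p = a1 + a2 + k * B * int N2" and "q = a1 + a2 - k * B * int N1"
  have B: "B > 0" using assms by (simp add: B_def mult_neg_pos)
  have "nat b * m \<ge> 1" using mult_le_mono[of 1 "nat b" 1 m] assms by simp
  then have M: "M \<ge> 1" unfolding M_def N2_def by linarith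
  have 1: "chain e N1 a1 B" "chain e N2 a2 (- B)"
    using a1 a2 assms by (simp_all add: N1_def N2_def B_def mult.commute)
  have "chain e M p 0" using chain_trans[OF e(2) 1] by (simp add: M_def p_def)
  moreover have "chain e M q 0"
    using chain_trans[OF e(2) 1(2,1)] by (simp add: M_def q_def algebra_simps)
  ultimately have "chain e (s * M) (int s * p) 0" "chain e (s * M) (int s * q) 0" for s
    using chain_power[OF e, of M p 0 s] chain_power[OF e, of M q 0 s] by auto
  then have pq: "chain e (s * M + t * M) (int s * p + int t * q) 0" for s t
    using chain_trans[OF e(2), of "s * M" "int s * p" 0 "t * M" "int t * q" 0] by simp
  have diff: "p - q = k * B * int M" by (simp add: p_def q_def M_def algebra_simps)
  text \<open>The mean drifts \<open>p / M\<close> and \<open>q / M\<close> differ by the nonzero integer \<open>k * B\<close>, so an integer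
    lies between them and is a convex combination of them.\<close>
  have "\<bar>p - q\<bar> \<ge> int M"
  proof -
    have "k * B \<noteq> 0" using k_nonzero B by simp
    then have "\<bar>k * B\<bar> \<ge> 1" by linarith
    then have "\<bar>k * B\<bar> * int M \<ge> 1 * int M" by (intro mult_right_mono) auto
    then show ?thesis by (simp add: diff abs_mult)
  qed
  define j where "j = max p q div int M"
  have j: "max p q - j * int M \<ge> 0" "max p q - j * int M < int M"
  proof -
    have "max p q - j * int M = max p q mod int M" by (simp add: j_def minus_div_mult_eq_mod)
    then show "max p q - j * int M \<ge> 0" "max p q - j * int M < int M" using M by auto
  qed
  then have "min p q - j * int M < 0" using \<open>\<bar>p - q\<bar> \<ge> int M\<close> by linarith
  \<comment> \<open>Each loop is weighted by the deviation of the other one from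
    \<open>j * int M\<close>; as the deviations have opposite signs, or one is 0, they
    cancel.\<close>
  define s t where "s = nat \<bar>q - j * int M\<bar>" and "t = nat \<bar>p - j * int M\<bar>"
  have "int s * (p - j * int M) + int t * (q - j * int M) = 0"
    using j \<open>min p q - j * int M < 0\<close> by (cases "p \<le> q") (auto simp: s_def t_def abs_if algebra_simps)
  then have "int s * p + int t * q = j * int (s * M + t * M)" by (simp add: algebra_simps)
  moreover have "s * M + t * M \<ge> 1"
  proof -
    have "s + t \<ge> 1" using \<open>min p q - j * int M < 0\<close> by (auto simp: s_def t_def)
    then show ?thesis using M by (simp flip: add_mult_distrib)
  qed
  ultimately show False using pq[of s t] no_closed_chain[OF e(2) free, of "s * M + t * M" j] by simp
qed

lemma free_radius:
  obtains e where "e > 0" "e \<le> 1/2" "\<And>E z. E \<in> pieces e \<Longrightarrow> z \<in> ball 0 e \<Longrightarrow> G z \<notin> E"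
proof -
  define \<Lambda> where "\<Lambda> = {z. Re z \<in> \<int> \<and> Im z \<in> \<int>}"
  have "\<Lambda> = Re -` \<int> \<inter> Im -` \<int>" by (auto simp: \<Lambda>_def)
  also have "closed \<dots>" by (intro closed_Int closed_vimage continuous_intros closed_Ints)
  finally have "open (- \<Lambda>)" by (rule open_Compl)
  moreover have "G 0 \<in> - \<Lambda>"
    using no_fixed_point[of 0] by (auto simp: \<Lambda>_def Ints_def complex_eq_iff)
  ultimately obtain r where r: "r > 0" "ball (G 0) r \<subseteq> - \<Lambda>" using open_contains_ball by blast
  obtain \<delta> where \<delta>: "\<delta> > 0" "\<And>z. dist z 0 < \<delta> \<Longrightarrow> dist (G z) (G 0) < r / 2"
    using cont[of UNIV] r(1) unfolding continuous_on_iff by (metis UNIV_I half_gt_zero)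
  \<comment> \<open>Half of the margin \<open>r\<close> pays for the variation of \<open>G\<close>
    on the disc, half for the radius of a piece; 1/2 keeps the pieces disjoint.\<close>
  define e where "e = min (min (1/2) \<delta>) (r / 2)"
  show thesis
  proof (rule that[of e])
    show "e > 0" "e \<le> 1/2" using r \<delta> by (auto simp: e_def)
    fix E :: "complex set" and z :: complex
    assume E: "E \<in> pieces e" and z: "z \<in> ball 0 e"
    show "G z \<notin> E"
    proof
      assume "G z \<in> E"
      then obtain a b where "dist (lattice_pt a b) (G z) < e" using E by (auto simp: pieces_def)
      moreover have "dist (G z) (G 0) < r / 2" using \<delta>(2)[of z] z by (simp add: e_def dist_commute)
      ultimately have "dist (lattice_pt a b) (G 0) < r"
        using dist_triangle[of "lattice_pt a b" "G 0" "G z"] by (simp add: e_def)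
      then have "lattice_pt a b \<in> ball (G 0) r" by (simp add: dist_commute)
      then have "lattice_pt a b \<in> - \<Lambda>" using r(2) by blast
      then show False by (simp add: \<Lambda>_def)
    qed
  qed
qed

text \<open>The points whose forward orbits avoid all discs form a closed invariant set missing 0,
  which minimality forces to be empty; compactness makes the waiting time uniform.\<close>

lemma uniform_visits:
  assumes "e > 0"
  obtains N where "\<And>z. \<exists>n\<le>N. \<exists>E\<in>pieces e. (G ^^ n) z \<in> E"
proof (rule periodic_open_cover_uniform[of "\<lambda>n z. \<exists>E\<in>pieces e. (G ^^ n) z \<in> E"])
  show op: "open {z. \<exists>E\<in>pieces e. (G ^^ n) z \<in> E}" for n
  proof -
    have "{z. \<exists>E\<in>pieces e. (G ^^ n) z \<in> E} = (G ^^ n) -` \<Union>(pieces e)" by auto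
    then show ?thesis by (auto simp: pieces_def intro!: open_vimage cont_iter open_Union)
  qed
  have add: "\<exists>E\<in>pieces e. z + lattice_pt a b \<in> E" if z: "\<exists>E\<in>pieces e. z \<in> E" for z a b
  proof -
    obtain a' b' where "z \<in> ball (lattice_pt a' b') e" using z by (rule in_piecesE)
    then have "z + lattice_pt a b \<in> ball (lattice_pt (a' + a) (b' + b)) e"
      unfolding lattice_pt_add[symmetric] mem_ball_lattice .
    then show ?thesis by (rule ball_in_pieces)
  qed
  then show per: "\<exists>E\<in>pieces e. (G ^^ n) (z + lattice_pt a b) \<in> E"
    if "\<exists>E\<in>pieces e. (G ^^ n) z \<in> E" for n z a b
    using that unfolding iter_add by blast
  show "\<exists>n. \<exists>E\<in>pieces e. (G ^^ n) z \<in> E" for z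
  proof (rule ccontr)
    assume not: "\<nexists>n. \<exists>E\<in>pieces e. (G ^^ n) z \<in> E"
    define S where "S = (\<Inter>n. - {z. \<exists>E\<in>pieces e. (G ^^ n) z \<in> E})"
    have "closed S" unfolding S_def using op by (intro closed_INT) (auto simp: closed_def)
    moreover have "z \<in> S" using not by (auto simp: S_def)
    then have "S \<noteq> {}" by blast
    moreover have "w + lattice_pt a b \<in> S" if "w \<in> S" for w a b
    proof (rule ccontr)
      assume "w + lattice_pt a b \<notin> S"
      then obtain n where "\<exists>E\<in>pieces e. (G ^^ n) (w + lattice_pt a b) \<in> E" by (auto simp: S_def)
      from per[OF this, of "- a" "- b"] have "\<exists>E\<in>pieces e. (G ^^ n) w \<in> E"
        by (simp add: add.assoc lattice_pt_add)
      then show False using that by (auto simp: S_def)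
    qed
    moreover have "G w \<in> S" if "w \<in> S" for w
    proof -
      have "\<not> (\<exists>E\<in>pieces e. (G ^^ Suc n) w \<in> E)" for n using that unfolding S_def by blast
      then show ?thesis by (simp add: S_def funpow_swap1)
    qed
    ultimately have "S = UNIV" by (rule minimal)
    then have "0 \<in> S" by simp
    then have "\<not> (\<exists>E\<in>pieces e. (G ^^ 0) 0 \<in> E)" unfolding S_def by blast
    moreover have "0 \<in> ball (lattice_pt 0 0) e" using assms by simp
    ultimately show False using ball_in_pieces by (metis funpow_0)
  qed
qed (use that in blast)

lemma chain_of_large_displacement:
  assumes e: "e > 0" "e \<le> 1/2" and \<sigma>: "\<sigma> = 1 \<or> \<sigma> = (- 1 :: real)"
    and unb: "\<And>C. \<exists>z n. \<sigma> * (Im ((G ^^ n) z) - Im z) > C"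
  obtains n a b where "n \<ge> 1" "chain e n a b" "\<sigma> * of_int b > 0"
proof -
  obtain d where d: "d \<ge> 0" "\<And>z n. \<bar>Im ((G ^^ n) z) - Im z\<bar> \<le> real n * d"
    using displacement_bounded by blast
  obtain N where N: "\<And>z. \<exists>n\<le>N. \<exists>E\<in>pieces e. (G ^^ n) z \<in> E"
    using uniform_visits[OF e(1)] by blast
  \<comment> \<open>Waiting for a disc costs at most \<open>real N * d\<close> of height at each
    end, and replacing a point by the centre of its disc less than 1/2 each time.\<close>
  obtain z n where zn: "\<sigma> * (Im ((G ^^ n) z) - Im z) > 2 * (real N * d) + 2"
    using unb by blast
  obtain m where m: "m \<le> N" "\<exists>E\<in>pieces e. (G ^^ m) z \<in> E" using N by blast
  obtain a b where ab: "(G ^^ m) z \<in> ball (lattice_pt a b) e" using m(2) by (rule in_piecesE)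
  obtain l where l: "l \<le> N" "\<exists>E\<in>pieces e. (G ^^ l) ((G ^^ n) z) \<in> E" using N by blast
  obtain a' b' where ab': "(G ^^ l) ((G ^^ n) z) \<in> ball (lattice_pt a' b') e"
    using l(2) by (rule in_piecesE)
  have mono: "real i * d \<le> real N * d" if "i \<le> N" for i
    using that d(1) by (intro mult_right_mono) auto
  have "n > N"
  proof (rule ccontr)
    assume "\<not> n > N"
    then have "\<bar>Im ((G ^^ n) z) - Im z\<bar> \<le> real N * d" using d(2)[of n z] mono[of n] by linarith
    moreover have "real N * d \<ge> 0" using d by simp
    ultimately show False using zn \<sigma> by auto
  qed
  define w where "w = (G ^^ m) z + lattice_pt (- a) (- b)"
  define r where "r = l + n - m"
  have "r \<ge> 1" using \<open>n > N\<close> m(1) by (simp add: r_def)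
  have "(G ^^ r) ((G ^^ m) z) = (G ^^ (r + m)) z" by (simp add: funpow_add)
  also have "r + m = l + n" using \<open>n > N\<close> m(1) by (simp add: r_def)
  finally have it: "(G ^^ r) ((G ^^ m) z) = (G ^^ l) ((G ^^ n) z)" by (simp add: funpow_add)
  \<comment> \<open>An orbit segment is a chain without jumps. Translating it back by
    \<open>(a, b)\<close> makes it start in the disc at 0; the twist of this translation over
    \<open>r\<close> steps gives the last term.\<close>
  have "chain e r (a' - a - k * b * int r) (b' - b)"
    unfolding chain_def
  proof (intro exI[of _ "\<lambda>i. (G ^^ i) w"] conjI allI impI)
    show "(G ^^ 0) w \<in> ball 0 e"
      using ab mem_ball_lattice[of "(G ^^ m) z" "- a" "- b" "lattice_pt a b" e]
      by (simp add: w_def lattice_pt_add)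
    have "(G ^^ r) w = (G ^^ l) ((G ^^ n) z) + lattice_pt (- a - k * b * int r) (- b)"
      unfolding w_def iter_add it by simp
    moreover have "lattice_pt (a' - a - k * b * int r) (b' - b) =
        lattice_pt a' b' + lattice_pt (- a - k * b * int r) (- b)" by (simp add: complex_eq_iff)
    ultimately show "(G ^^ r) w \<in> ball (lattice_pt (a' - a - k * b * int r) (b' - b)) e"
      using ab' by (simp only: mem_ball_lattice)
  qed auto
  moreover have "\<sigma> * of_int (b' - b) > 0"
  proof -
    have "\<bar>of_int b - Im ((G ^^ m) z)\<bar> < 1/2" "\<bar>of_int b' - Im ((G ^^ l) ((G ^^ n) z))\<bar> < 1/2"
      using ab ab' e(2) abs_Im_le_cmod[of "lattice_pt a b - (G ^^ m) z"]
        abs_Im_le_cmod[of "lattice_pt a' b' - (G ^^ l) ((G ^^ n) z)"] by (auto simp: dist_norm)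
    moreover have "\<bar>Im ((G ^^ m) z) - Im z\<bar> \<le> real N * d"
      "\<bar>Im ((G ^^ l) ((G ^^ n) z)) - Im ((G ^^ n) z)\<bar> \<le> real N * d"
      using d(2)[of m z] d(2)[of l "(G ^^ n) z"] mono m(1) l(1) by (meson order_trans)+
    moreover have "\<sigma> = 1 \<Longrightarrow> Im ((G ^^ n) z) - Im z > 2 * (real N * d) + 2"
      "\<sigma> = - 1 \<Longrightarrow> Im z - Im ((G ^^ n) z) > 2 * (real N * d) + 2" using zn by auto
    ultimately have "\<sigma> = 1 \<Longrightarrow> of_int b' - of_int b > (0 :: real)"
      "\<sigma> = - 1 \<Longrightarrow> of_int b - of_int b' > (0 :: real)" by linarith+
    then show ?thesis using \<sigma> by auto
  qed
  ultimately show thesis using that \<open>r \<ge> 1\<close> by blast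
qed

section \<open>One-sided bounds and linear drift\<close>

theorem displacement_one_sided_bounded:
  obtains \<sigma> C :: real where "\<sigma> = 1 \<or> \<sigma> = - 1" "\<And>z n. \<sigma> * (Im ((G ^^ n) z) - Im z) \<le> C"
proof (rule ccontr)
  note bounded = that
  assume not: "\<not> thesis"
  obtain e where e: "e > 0" "e \<le> 1/2" "\<And>E z. E \<in> pieces e \<Longrightarrow> z \<in> ball 0 e \<Longrightarrow> G z \<notin> E"
    using free_radius by blast
  have unb: "\<exists>z n. \<sigma> * (Im ((G ^^ n) z) - Im z) > C" if \<sigma>: "\<sigma> = 1 \<or> \<sigma> = - 1" for \<sigma> C
  proof (rule ccontr)
    assume "\<not> ?thesis"
    then have "\<And>z n. \<sigma> * (Im ((G ^^ n) z) - Im z) \<le> C" by (simp add: not_less)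
    then show False using not bounded[OF \<sigma>] by blast
  qed
  obtain n a b where 1: "n \<ge> 1" "chain e n a b" "1 * real_of_int b > 0"
    using chain_of_large_displacement[OF e(1,2), of 1] unb by (metis (full_types))
  obtain m c d where 2: "m \<ge> 1" "chain e m c d" "- 1 * real_of_int d > 0"
    using chain_of_large_displacement[OF e(1,2), of "- 1"] unb by (metis (full_types))
  show False
    using no_opposite_chains[OF e 1(2) 2(2) 1(1) 2(1)] 1(3) 2(3) by simp
qed

text \<open>An orbit that rises by at most \<open>C\<close> but is unbounded must drop by more than
  \<open>C + 1\<close>, and by compactness within \<open>N\<close> steps. By time \<open>n\<close>
  there have been \<open>n div N\<close> such drops, and at most \<open>C\<close> is regained
  afterwards; counting each drop as 1 gives the rate \<open>1 / N\<close>.\<close>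

lemma linear_drift:
  obtains \<sigma> \<delta> C :: real where "\<sigma> = 1 \<or> \<sigma> = - 1" "\<delta> > 0"
    "\<And>z n. \<sigma> * (Im ((G ^^ n) z) - Im z) \<le> C - \<delta> * real n"
proof -
  obtain \<sigma> C :: real where \<sigma>: "\<sigma> = 1 \<or> \<sigma> = - 1"
    and C: "\<And>z n. \<sigma> * (Im ((G ^^ n) z) - Im z) \<le> C"
    using displacement_one_sided_bounded by blast
  have C0: "C \<ge> 0" using C[of 0 0] by simp
  obtain N where N: "\<And>z. \<exists>n\<le>N. \<sigma> * (Im ((G ^^ n) z) - Im z) < - (C + 1)"
  proof (rule periodic_open_cover_uniform[of "\<lambda>n z. \<sigma> * (Im ((G ^^ n) z) - Im z) < - (C + 1)"])
    show "open {z. \<sigma> * (Im ((G ^^ n) z) - Im z) < - (C + 1)}" for n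
      by (intro open_Collect_less continuous_intros cont_iter)
    show "\<exists>n. \<sigma> * (Im ((G ^^ n) z) - Im z) < - (C + 1)" for z
    proof (rule ccontr)
      assume "\<nexists>n. \<sigma> * (Im ((G ^^ n) z) - Im z) < - (C + 1)"
      then have "\<sigma> * (Im ((G ^^ n) z) - Im z) \<ge> - (C + 1)" for n by (meson not_less)
      moreover have "\<sigma> * (Im ((G ^^ n) z) - Im z) \<le> C + 1" for n using C[of n z] by simp
      ultimately have "\<bar>\<sigma> * (Im ((G ^^ n) z) - Im z)\<bar> \<le> C + 1" for n by (simp add: abs_le_iff minus_le_iff)
      then have "\<forall>n. \<bar>Im ((G ^^ n) z) - Im z\<bar> \<le> C + 1"
        using \<sigma> by (simp add: abs_mult) (metis abs_1 abs_minus_cancel mult_1)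
      then show False using no_bounded_orbit by blast
    qed
    show "\<sigma> * (Im ((G ^^ n) (z + lattice_pt a b)) - Im (z + lattice_pt a b)) < - (C + 1)"
      if "\<sigma> * (Im ((G ^^ n) z) - Im z) < - (C + 1)" for n z a b
      using that by (simp add: iter_add)
  qed (rule that)
  have N1: "N \<ge> 1"
  proof (rule ccontr)
    assume "\<not> N \<ge> 1"
    then have "N = 0" by simp
    then show False using N[of 0] C0 by simp
  qed
  have step: "\<exists>m\<le>j * N. \<sigma> * (Im ((G ^^ m) z) - Im z) \<le> - (real j * (C + 1))" for j z
  proof (induction j arbitrary: z)
    case (Suc j)
    obtain n where n: "n \<le> N" "\<sigma> * (Im ((G ^^ n) z) - Im z) < - (C + 1)" using N by blast
    obtain m where m: "m \<le> j * N"
      "\<sigma> * (Im ((G ^^ m) ((G ^^ n) z)) - Im ((G ^^ n) z)) \<le> - (real j * (C + 1))"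
      using Suc by blast
    have "\<sigma> * (Im ((G ^^ (m + n)) z) - Im z) \<le> - (real (Suc j) * (C + 1))"
      using n(2) m(2) by (simp add: funpow_add algebra_simps)
    then show ?case using n(1) m(1) by (intro exI[of _ "m + n"]) auto
  qed auto
  have "\<sigma> * (Im ((G ^^ n) z) - Im z) \<le> (C + 1) - (1 / real N) * real n" for z n
  proof -
    obtain m where m: "m \<le> n div N * N"
      "\<sigma> * (Im ((G ^^ m) z) - Im z) \<le> - (real (n div N) * (C + 1))" using step by blast
    have "m \<le> n" using m(1) div_times_less_eq_dividend[of n N] by linarith
    then have "(G ^^ n) z = (G ^^ (n - m)) ((G ^^ m) z)"
      by (metis comp_apply funpow_add le_add_diff_inverse2)
    then have "\<sigma> * (Im ((G ^^ n) z) - Im z) \<le> C - real (n div N) * (C + 1)"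
      using C[of "n - m" "(G ^^ m) z"] m(2) by (simp add: algebra_simps)
    also have "\<dots> \<le> C - real (n div N)"
      using mult_left_mono[of 1 "C + 1" "real (n div N)"] C0 by simp
    also have "real (n div N) \<ge> real n / real N - 1"
    proof -
      have "n = n div N * N + n mod N" by (simp only: div_mult_mod_eq)
      moreover have "n mod N \<le> N" using N1 by (simp add: less_imp_le)
      ultimately have "n \<le> (n div N + 1) * N" unfolding add_mult_distrib by linarith
      then have "real n \<le> (real (n div N) + 1) * real N"
        by (metis of_nat_1 of_nat_add of_nat_le_iff of_nat_mult)
      then show ?thesis using N1 by (simp add: field_simps)
    qed
    then have "C - real (n div N) \<le> (C + 1) - (1 / real N) * real n" by simp
    finally show ?thesis .
  qed
  moreover have "1 / real N > 0" using N1 by simp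
  ultimately show thesis using that \<sigma> by blast
qed

section \<open>Powers of the map and rational rotation numbers\<close>

text \<open>For \<open>S\<close> invariant under the power, consider the residues
  \<open>i < q\<close> with \<open>(G ^^ i) z \<in> S\<close>. Closedness of \<open>S\<close> makes
  this set semicontinuous in \<open>z\<close>, and \<open>G\<close> shifts it cyclically, so it is
  constant; membership of the residue 0 is membership of \<open>z\<close> in
  \<open>S\<close>.\<close>

lemma minimal_twist_power:
  assumes "q \<ge> 1"
  shows "minimal_twist (\<lambda>z. (G ^^ q) z - lattice_pt 0 p) (k * int q)"
proof
  obtain g where g: "homeomorphism UNIV UNIV G g" using homeo by blast
  have "homeomorphism UNIV UNIV (G ^^ q) (g ^^ q)"
  proof (induction q)
    case 0
    then show ?case by (simp add: homeomorphism_ident id_def)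
  next
    case (Suc q)
    then show ?case using homeomorphism_compose[OF Suc g] by (simp add: funpow_Suc_right del: funpow.simps) (simp add: funpow_swap1 o_def)
  qed
  moreover have "homeomorphism UNIV UNIV (\<lambda>z. z - lattice_pt 0 p) (\<lambda>z. z + lattice_pt 0 p)"
    by (auto simp: homeomorphism_def surj_def image_iff intro!: continuous_intros)
  ultimately have "homeomorphism UNIV UNIV ((\<lambda>z. z - lattice_pt 0 p) \<circ> (G ^^ q)) ((g ^^ q) \<circ> (\<lambda>z. z + lattice_pt 0 p))"
    by (rule homeomorphism_compose)
  then show "\<exists>g. homeomorphism UNIV UNIV (\<lambda>z. (G ^^ q) z - lattice_pt 0 p) g"
    unfolding comp_def by blast
  show "(G ^^ q) (z + lattice_pt a b) - lattice_pt 0 p =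
      (G ^^ q) z - lattice_pt 0 p + lattice_pt (a + k * int q * b) b" for z a b
    by (simp add: iter_add complex_eq_iff)
  show "k * int q \<noteq> 0" using k_nonzero assms by simp
  fix S :: "complex set"
  assume S: "closed S" "S \<noteq> {}" "\<And>z a b. z \<in> S \<Longrightarrow> z + lattice_pt a b \<in> S"
    "\<And>z. z \<in> S \<Longrightarrow> (G ^^ q) z - lattice_pt 0 p \<in> S"
  have Sq: "(G ^^ q) z \<in> S" if "z \<in> S" for z
    using S(3)[OF S(4)[OF that], of 0 p] by simp
  have Sper: "z + lattice_pt a b \<in> S \<longleftrightarrow> z \<in> S" for z a b
    using S(3)[of z a b] S(3)[of "z + lattice_pt a b" "- a" "- b"] by (auto simp: add.assoc lattice_pt_add)
  define J where "J = (\<lambda>z. int ` {i. i < q \<and> (G ^^ i) z \<in> S})"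
  have fin: "finite (J z)" for z by (simp add: J_def)
  have "J z = J w" for z w
  proof (rule upper_semicontinuous_imp_constant[of J])
    show "\<exists>U. open U \<and> z \<in> U \<and> (\<forall>w\<in>U. J w \<subseteq> J z)" for z
    proof (intro exI conjI)
      show "open (\<Inter>i\<in>{i. i < q \<and> (G ^^ i) z \<notin> S}. (G ^^ i) -` (- S))"
        using S(1) by (intro open_INT ballI open_vimage cont_iter) auto
    qed (auto simp: J_def)
    show "card (J (z + lattice_pt a b)) = card (J z)" for z a b
      by (simp add: J_def iter_add Sper)
    show "card (J z) \<le> card (J (G z))" for z
    proof -
      \<comment> \<open>The cyclic shift of the residues modulo \<open>q\<close>; its wrap-around at
        0 is where invariance of \<open>S\<close> under \<open>G ^^ q\<close> enters.\<close>
      define s where "s = (\<lambda>i::int. if i = 0 then int q - 1 else i - 1)"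
      have "inj_on s (J z)"
        by (rule inj_onI) (auto simp: s_def J_def split: if_splits)
      moreover have "s ` J z \<subseteq> J (G z)"
      proof safe
        fix i assume "i \<in> J z"
        then obtain m where m: "i = int m" "m < q" "(G ^^ m) z \<in> S" by (auto simp: J_def)
        show "s i \<in> J (G z)"
        proof (cases m)
          case 0
          then have "(G ^^ q) z \<in> S" using m Sq by simp
          then have "(G ^^ (q - 1)) (G z) \<in> S"
            using assms by (cases q) (auto simp: funpow_swap1)
          then have "int (q - 1) \<in> J (G z)" unfolding J_def using assms by (intro imageI) simp
          then show ?thesis using m 0 assms by (simp add: s_def of_nat_diff)
        next
          case (Suc m')
          then have "(G ^^ m') (G z) \<in> S" using m by (simp add: funpow_swap1)
          then have "int m' \<in> J (G z)" unfolding J_def using m Suc by (intro imageI) simp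
          then show ?thesis using m Suc by (simp add: s_def)
        qed
      qed
      ultimately show ?thesis using card_inj_on_le fin by blast
    qed
  qed (rule fin)
  moreover have "0 \<in> J z \<longleftrightarrow> z \<in> S" for z
    using assms by (auto simp: J_def image_iff)
  ultimately show "S = UNIV" using S(2) by blast
qed

text \<open>For \<open>r = p / q\<close> the map \<open>G ^^ q\<close> followed by the vertical
  translation by \<open>- p\<close> measures the deviation of heights from slope \<open>r\<close>.
  Its linear drift passes to \<open>G\<close>, since the fewer than \<open>q\<close> leftover
  iterates cost only a constant.\<close>

lemma rational_one_sided:
  fixes r :: real
  assumes "r \<in> \<rat>"
  obtains \<sigma> \<delta> C :: real where "\<sigma> = 1 \<or> \<sigma> = - 1" "\<delta> > 0"
    "\<And>z n. \<sigma> * (Im ((G ^^ n) z) - Im z - real n * r) \<le> C - \<delta> * real n"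
proof -
  obtain p :: int and q :: nat where q: "q \<ge> 1" and r: "r = of_int p / real q"
  proof -
    obtain m n :: int where "n > 0" "r = of_int m / of_int n"
      using assms by (rule Rats_cases')
    then show thesis using that[of "nat n" m] by simp
  qed
  interpret H: minimal_twist "\<lambda>z. (G ^^ q) z - lattice_pt 0 p" "k * int q"
    by (rule minimal_twist_power[OF q])
  define H where "H = (\<lambda>z. (G ^^ q) z - lattice_pt 0 p)"
  have H: "H x = (G ^^ q) x - lattice_pt 0 p" for x by (simp add: H_def)
  have "\<exists>c. (H ^^ m) z = (G ^^ (q * m)) z + lattice_pt c (- p * int m)" for m z
  proof (induction m)
    case 0
    show ?case by (intro exI[of _ 0]) simp
  next
    case (Suc m)
    then obtain c where c: "(H ^^ m) z = (G ^^ (q * m)) z + lattice_pt c (- p * int m)" by blast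
    have "(H ^^ Suc m) z = (G ^^ (q * Suc m)) z + lattice_pt (c + k * (- p * int m) * int q) (- p * int (Suc m))"
      by (simp add: c H iter_add funpow_add complex_eq_iff algebra_simps)
    then show ?case by blast
  qed
  then have HG: "Im ((H ^^ m) z) = Im ((G ^^ (q * m)) z) - of_int p * real m" for m z
    by (metis add.right_neutral add_uminus_conv_diff lattice_pt_sel(2) mult_minus_left of_int_minus
        of_int_mult of_int_of_nat_eq plus_complex.simps(2))
  obtain \<sigma> \<delta> C :: real where \<sigma>: "\<sigma> = 1 \<or> \<sigma> = - 1" and \<delta>: "\<delta> > 0"
    and C: "\<And>z n. \<sigma> * (Im ((H ^^ n) z) - Im z) \<le> C - \<delta> * real n"
    using H.linear_drift unfolding H_def by blast
  obtain d where d: "d \<ge> 0" "\<And>z n. \<bar>Im ((G ^^ n) z) - Im z\<bar> \<le> real n * d"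
    using displacement_bounded by blast
  have "\<sigma> * (Im ((G ^^ n) z) - Im z - real n * r) \<le>
      (C + real q * (d + \<bar>r\<bar>) + \<delta>) - \<delta> / real q * real n" for z n
  proof -
    define m s where "m = n div q" and "s = n mod q"
    have n: "n = s + q * m" by (simp add: m_def s_def)
    have sq: "s \<le> q" using q by (simp add: s_def less_imp_le)
    define w where "w = (G ^^ (q * m)) z"
    have "real n * r = real s * r + of_int p * real m"
      using q by (simp add: n r field_simps)
    then have split: "Im ((G ^^ n) z) - Im z - real n * r =
        (Im ((H ^^ m) z) - Im z) + (Im ((G ^^ s) w) - Im w - real s * r)"
      by (simp add: HG w_def n funpow_add)
    have "\<bar>Im ((G ^^ s) w) - Im w - real s * r\<bar> \<le> real s * d + real s * \<bar>r\<bar>"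
      using d(2)[of s w] abs_triangle_ineq4[of "Im ((G ^^ s) w) - Im w" "real s * r"] by (simp add: abs_mult)
    also have "\<dots> = real s * (d + \<bar>r\<bar>)" by (simp add: algebra_simps)
    also have "\<dots> \<le> real q * (d + \<bar>r\<bar>)" using sq d(1) by (intro mult_right_mono) auto
    finally have "\<sigma> * (Im ((G ^^ s) w) - Im w - real s * r) \<le> real q * (d + \<bar>r\<bar>)"
      using \<sigma> by (auto simp: abs_le_iff)
    moreover have "\<delta> * real m \<ge> \<delta> / real q * real n - \<delta>"
    proof -
      have "real n \<le> real q + real q * real m" using sq by (simp add: n)
      then have "\<delta> * real n \<le> \<delta> * (real q + real q * real m)" using \<delta> by simp
      then show ?thesis using q by (simp add: field_simps)
    qed
    ultimately show ?thesis
      using C[of m z] unfolding split by (simp add: distrib_left)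
  qed
  moreover have "\<delta> / real q > 0" using \<delta> q by simp
  ultimately show thesis using that[OF \<sigma>] by blast
qed

section \<open>The set of limits of mean vertical displacements\<close>

definition mean_displacements :: "nat \<Rightarrow> real set" where
  "mean_displacements n = range (\<lambda>z. (Im ((G ^^ n) z) - Im z) / real n)"

theorem rotation_set_irrational_singleton:
  obtains \<alpha> where "\<alpha> \<notin> \<rat>" "(\<Inter>i\<in>{1..}. closure (\<Union>n\<in>{i..}. mean_displacements n)) = {\<alpha>}"
proof -
  define R where "R = (\<Inter>i\<in>{1..}. closure (\<Union>n\<in>{i..}. mean_displacements n))"
  have R: "\<exists>n z. n \<ge> i \<and> \<bar>(Im ((G ^^ n) z) - Im z) / real n - x\<bar> < e"
    if x: "x \<in> R" "i \<ge> 1" and e: "e > 0" for x e and i :: nat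
  proof -
    have "x \<in> closure (\<Union>n\<in>{i..}. mean_displacements n)" using x by (auto simp: R_def)
    then obtain y where "y \<in> (\<Union>n\<in>{i..}. mean_displacements n)" "dist y x < e"
      using e unfolding closure_approachable by blast
    then show ?thesis by (auto simp: mean_displacements_def dist_real_def)
  qed
  have "R \<noteq> {}"
  proof -
    obtain d where d: "d \<ge> 0" "\<And>z n. \<bar>Im ((G ^^ n) z) - Im z\<bar> \<le> real n * d"
      using displacement_bounded by blast
    define a where "a = (\<lambda>n. (Im ((G ^^ n) 0) - Im 0) / real n)"
    \<comment> \<open>Division by 0 yields \<open>a 0 = 0\<close>, so the bound includes
      \<open>n = 0\<close>.\<close>
    have "a n \<in> {- d .. d}" for n
    proof (cases "n = 0")
      case False
      then have "\<bar>a n\<bar> \<le> d" using d(2)[of n 0] by (simp add: a_def field_simps)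
      then show ?thesis by auto
    qed (use d(1) in \<open>simp add: a_def\<close>)
    moreover have "seq_compact {- d .. d}" using compact_imp_seq_compact by blast
    ultimately obtain l \<rho> where l: "strict_mono \<rho>" "(a \<circ> \<rho>) \<longlonglongrightarrow> l"
      unfolding seq_compact_def by metis
    have "l \<in> closure (\<Union>n\<in>{i..}. mean_displacements n)" for i
    proof (rule Lim_in_closed_set[OF closed_closure _ _ l(2)])
      have "(a \<circ> \<rho>) j \<in> closure (\<Union>n\<in>{i..}. mean_displacements n)" if "j \<ge> i" for j
      proof -
        have "\<rho> j \<ge> i" using that seq_suble[OF l(1), of j] by linarith
        then have "(a \<circ> \<rho>) j \<in> (\<Union>n\<in>{i..}. mean_displacements n)"
          by (intro UN_I[of "\<rho> j"]) (auto simp: a_def mean_displacements_def intro!: image_eqI[of _ _ 0])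
        then show ?thesis by (rule subsetD[OF closure_subset])
      qed
      then show "\<forall>\<^sub>F j in sequentially. (a \<circ> \<rho>) j \<in> closure (\<Union>n\<in>{i..}. mean_displacements n)"
        unfolding eventually_sequentially by blast
    qed simp
    then show ?thesis by (auto simp: R_def)
  qed
  then obtain \<alpha> where \<alpha>: "\<alpha> \<in> R" by blast
  have side: "\<exists>\<sigma>. (\<sigma> = 1 \<or> \<sigma> = - 1) \<and> (\<forall>x\<in>R. \<sigma> * (x - r) < 0)" if r: "r \<in> \<rat>" for r :: real
  proof -
    obtain \<sigma> \<delta> C :: real where \<sigma>: "\<sigma> = 1 \<or> \<sigma> = - 1" and \<delta>: "\<delta> > 0"
      and C: "\<And>z n. \<sigma> * (Im ((G ^^ n) z) - Im z - real n * r) \<le> C - \<delta> * real n"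
      using rational_one_sided[OF r] by blast
    have "\<sigma> * (x - r) < 0" if x: "x \<in> R" for x
    proof -
      \<comment> \<open>From this time on \<open>C\<close> is less than half of
        \<open>\<delta> * real n\<close>, so mean displacements lie more than
        \<open>\<delta> / 2\<close> to one side of \<open>r\<close>. Approximating \<open>x\<close>
        to within \<open>\<delta> / 2\<close> then keeps the inequality strict in the
        closure.\<close>
      obtain i :: nat where i: "real i > \<bar>C\<bar> * 2 / \<delta> + 1" using reals_Archimedean2 by blast
      then have "i \<ge> 1" using \<delta> by (smt (verit) divide_nonneg_pos mult_nonneg_nonneg of_nat_1 of_nat_le_iff)
      then obtain n z where n: "n \<ge> i" "\<bar>(Im ((G ^^ n) z) - Im z) / real n - x\<bar> < \<delta> / 2"
        using R[OF x, of i "\<delta> / 2"] \<delta> by auto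
      then have n0: "real n > 0" "real n > \<bar>C\<bar> * 2 / \<delta>" using i \<open>i \<ge> 1\<close> by auto
      define y where "y = (Im ((G ^^ n) z) - Im z) / real n"
      have "real n * (\<sigma> * (y - r)) = \<sigma> * (Im ((G ^^ n) z) - Im z - real n * r)"
        using n0 by (simp add: y_def field_simps)
      also have "\<dots> \<le> C - \<delta> * real n" by (rule C)
      also have "\<dots> < real n * (- \<delta> / 2)" using n0 \<delta> by (simp add: field_simps abs_if split: if_splits)
      finally have "\<sigma> * (y - r) < - \<delta> / 2" using n0(1) by (simp only: mult_less_cancel_left_pos)
      moreover have "\<bar>y - x\<bar> < \<delta> / 2" using n(2) by (simp add: y_def)
      moreover have "\<sigma> = 1 \<Longrightarrow> \<sigma> * (y - r) = y - r" "\<sigma> = - 1 \<Longrightarrow> \<sigma> * (y - r) = r - y" by auto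
      ultimately have "\<sigma> = 1 \<Longrightarrow> x - r < 0" "\<sigma> = - 1 \<Longrightarrow> r - x < 0" by linarith+
      then show ?thesis using \<sigma> by auto
    qed
    then show ?thesis using \<sigma> by blast
  qed
  have "\<alpha> \<notin> \<rat>" using side[of \<alpha>] \<alpha> by fastforce
  moreover have "R = {\<alpha>}"
  proof (rule ccontr)
    assume "R \<noteq> {\<alpha>}"
    then obtain \<beta> where \<beta>: "\<beta> \<in> R" "\<beta> \<noteq> \<alpha>" using \<alpha> by blast
    have "min \<alpha> \<beta> < max \<alpha> \<beta>" using \<beta>(2) by linarith
    then obtain r where r: "r \<in> \<rat>" "min \<alpha> \<beta> < r" "r < max \<alpha> \<beta>"
      using Rats_dense_in_real by blast
    obtain \<sigma> where "\<sigma> = 1 \<or> \<sigma> = - 1" "\<sigma> * (\<alpha> - r) < 0" "\<sigma> * (\<beta> - r) < 0"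
      using side[OF r(1)] \<alpha> \<beta>(1) by blast
    then show False using r(2,3) by (auto simp: min_def max_def split: if_splits)
  qed
  ultimately show thesis using that[of \<alpha>] by (simp add: R_def)
qed

end

section \<open>Lifting from the torus\<close>

lemma continuous_Ints_valued_constant:
  fixes f :: "'a::topological_space \<Rightarrow> real"
  assumes "connected S" "continuous_on S f" "\<And>x. x \<in> S \<Longrightarrow> f x \<in> \<int>"
  obtains n :: int where "\<And>x. x \<in> S \<Longrightarrow> f x = of_int n"
proof -
  have "f constant_on S"
  proof (rule continuous_discrete_range_constant[OF assms(1,2)])
    fix x assume x: "x \<in> S"
    have "1 \<le> norm (f y - f x)" if y: "y \<in> S" "f y \<noteq> f x" for y
    proof -
      have "f y - f x \<in> \<int>" "f y - f x \<noteq> 0" using assms(3) x y by auto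
      then show ?thesis using Ints_nonzero_abs_ge1[of "f y - f x"] by simp
    qed
    then show "\<exists>e>0. \<forall>y. y \<in> S \<and> f y \<noteq> f x \<longrightarrow> e \<le> norm (f y - f x)"
      by (intro exI[of _ 1]) auto
  qed
  then obtain c where c: "\<And>x. x \<in> S \<Longrightarrow> f x = c" by (auto simp: constant_on_def)
  show thesis
  proof (cases "S = {}")
    case False
    then obtain x where "x \<in> S" by auto
    then have "c \<in> \<int>" using c assms(3) by metis
    then show thesis using c that by (auto elim: Ints_cases)
  qed (use that in auto)
qed

section \<open>Lifts of maps into the circle and the torus\<close>

text \<open>The embedding of the circle as the complex unit circle turns lifting into the choice of
  a continuous logarithm.\<close>

lift_definition circle_exp :: "circle \<Rightarrow> complex" is "\<lambda>x. exp (2 * of_real pi * \<i> * of_real x)"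
proof -
  fix x y :: real assume "int_diff x y"
  then obtain n where n: "x - y = of_int n" by (auto simp: int_diff_def elim: Ints_cases)
  then have "x = y + of_int n" by simp
  then show "exp (2 * of_real pi * \<i> * of_real x) = exp (2 * of_real pi * \<i> * of_real y)"
    unfolding exp_eq by (intro exI[of _ n]) (simp add: algebra_simps)
qed

lemma circle_exp_to_circle: "circle_exp (to_circle x) = exp (2 * of_real pi * \<i> * of_real x)"
  by (rule circle_exp.abs_eq)

lemma to_circle_cases: obtains x where "a = to_circle x"
  using surj_to_circle by (metis surjD)

lemma norm_circle_exp: "norm (circle_exp a) = 1"
  by (rule to_circle_cases[of a]) (simp add: circle_exp_to_circle norm_exp_eq_Re)

lemma circle_exp_inject: "circle_exp a = circle_exp b \<Longrightarrow> a = b"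
proof -
  assume eq: "circle_exp a = circle_exp b"
  obtain x where x: "a = to_circle x" by (rule to_circle_cases)
  obtain y where y: "b = to_circle y" by (rule to_circle_cases)
  from eq obtain n :: int where "2 * of_real pi * \<i> * complex_of_real x =
      2 * of_real pi * \<i> * of_real y + 2 * of_int n * of_real pi * \<i>"
    unfolding x y circle_exp_to_circle exp_eq by (auto simp: algebra_simps)
  then have "2 * pi * x = 2 * pi * y + 2 * of_int n * pi"
    by (simp add: complex_eq_iff)
  then have "2 * pi * (x - y) = 2 * pi * of_int n" by (simp add: algebra_simps)
  then have "x - y = of_int n" by simp
  then show "a = b" unfolding x y to_circle_eq_iff by simp
qed

lemma continuous_circle_exp: "continuous_on UNIV circle_exp"
proof -
  have "open (circle_exp -` U)" if "open U" for U
  proof -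
    have "to_circle -` (circle_exp -` U) = (\<lambda>x. exp (2 * of_real pi * \<i> * of_real x)) -` U"
      by (auto simp: circle_exp_to_circle)
    also have "open \<dots>" using that by (intro open_vimage continuous_intros)
    finally show ?thesis by (simp add: open_circle_def)
  qed
  then show ?thesis by (simp add: continuous_on_open_vimage)
qed

lemma circle_lift:
  fixes \<phi> :: "'a::real_normed_vector \<Rightarrow> circle"
  assumes "continuous_on S \<phi>" "convex S"
  obtains \<psi> :: "'a \<Rightarrow> real" where "continuous_on S \<psi>" "\<And>x. x \<in> S \<Longrightarrow> to_circle (\<psi> x) = \<phi> x"
proof -
  have "continuous_on S (\<lambda>x. circle_exp (\<phi> x))"
    by (rule continuous_on_compose2[OF continuous_circle_exp assms(1)]) auto
  moreover have "circle_exp a \<noteq> 0" for a using norm_circle_exp[of a] by auto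
  ultimately obtain L where L: "continuous_on S L" "\<And>x. x \<in> S \<Longrightarrow> circle_exp (\<phi> x) = exp (L x)"
    using continuous_logarithm_on_contractible convex_imp_contractible[OF assms(2)] by metis
  define \<psi> where "\<psi> = (\<lambda>x. Im (L x) / (2 * pi))"
  have "to_circle (\<psi> x) = \<phi> x" if "x \<in> S" for x
  proof (rule circle_exp_inject)
    have "Re (L x) = 0" using L(2)[OF that] norm_circle_exp[of "\<phi> x"] by simp
    then have "2 * of_real pi * \<i> * of_real (\<psi> x) = L x"
      by (simp add: complex_eq_iff \<psi>_def)
    then show "circle_exp (to_circle (\<psi> x)) = circle_exp (\<phi> x)"
      by (simp add: circle_exp_to_circle L(2)[OF that])
  qed
  moreover have "continuous_on S \<psi>" unfolding \<psi>_def by (intro continuous_intros L(1)) auto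
  ultimately show thesis using that by blast
qed

definition plane_torus :: "complex \<Rightarrow> torus" where
  "plane_torus z = torus_proj (Re z, Im z)"

definition plane_cylinder :: "complex \<Rightarrow> cylinder" where
  "plane_cylinder z = (to_circle (Re z), Im z)"

lemma plane_torus_eq: "plane_torus z = (to_circle (Re z), to_circle (Im z))"
  by (simp add: plane_torus_def torus_proj_def)

lemma plane_torus_eq_iff: "plane_torus z = plane_torus w \<longleftrightarrow> (\<exists>a b. z = w + lattice_pt a b)"
proof
  assume "plane_torus z = plane_torus w"
  then have "Re z - Re w \<in> \<int>" "Im z - Im w \<in> \<int>"
    by (auto simp: plane_torus_def torus_proj_eq_iff)
  then obtain a b where "Re z - Re w = of_int a" "Im z - Im w = of_int b" by (auto elim!: Ints_cases)
  then show "\<exists>a b. z = w + lattice_pt a b"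
    by (intro exI[of _ a] exI[of _ b]) (auto simp: complex_eq_iff)
qed (auto simp: plane_torus_def torus_proj_eq_iff)

lemma surj_plane_torus: obtains z where "u = plane_torus z"
proof -
  obtain x where "u = torus_proj x" using surj_torus_proj by (metis surjD)
  then show thesis using that[of "Complex (fst x) (snd x)"] by (simp add: plane_torus_def)
qed

lemma surj_plane_cylinder: obtains z where "u = plane_cylinder z"
proof -
  obtain x where "fst u = to_circle x" by (rule to_circle_cases)
  then show thesis using that[of "Complex x (snd u)"] by (simp add: plane_cylinder_def prod_eq_iff)
qed

lemma continuous_plane_torus: "continuous_on S plane_torus"
  unfolding plane_torus_eq
  by (intro continuous_on_Pair continuous_on_compose2[OF continuous_to_circle] continuous_intros) auto

lemma continuous_plane_cylinder: "continuous_on S plane_cylinder"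
  unfolding plane_cylinder_def
  by (intro continuous_on_Pair continuous_on_compose2[OF continuous_to_circle] continuous_intros) auto

lemma torus_map_lift:
  fixes \<phi> :: "'a::real_normed_vector \<Rightarrow> torus"
  assumes "continuous_on S \<phi>" "convex S"
  obtains \<psi> :: "'a \<Rightarrow> complex" where "continuous_on S \<psi>" "\<And>x. x \<in> S \<Longrightarrow> plane_torus (\<psi> x) = \<phi> x"
proof -
  obtain \<psi>1 where 1: "continuous_on S \<psi>1" "\<And>x. x \<in> S \<Longrightarrow> to_circle (\<psi>1 x) = fst (\<phi> x)"
    using circle_lift[OF continuous_on_fst[OF assms(1)] assms(2)] by blast
  obtain \<psi>2 where 2: "continuous_on S \<psi>2" "\<And>x. x \<in> S \<Longrightarrow> to_circle (\<psi>2 x) = snd (\<phi> x)"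
    using circle_lift[OF continuous_on_snd[OF assms(1)] assms(2)] by blast
  show thesis
    by (rule that[of "\<lambda>x. Complex (\<psi>1 x) (\<psi>2 x)"])
      (auto intro!: continuous_intros 1 2 simp: plane_torus_eq prod_eq_iff 1(2) 2(2))
qed

lemma torus_lifts_differ_by_lattice:
  fixes \<phi> \<psi> :: "'a::topological_space \<Rightarrow> complex"
  assumes "continuous_on S \<phi>" "continuous_on S \<psi>" "connected S"
    and "\<And>x. x \<in> S \<Longrightarrow> plane_torus (\<phi> x) = plane_torus (\<psi> x)"
  obtains a b where "\<And>x. x \<in> S \<Longrightarrow> \<phi> x = \<psi> x + lattice_pt a b"
proof -
  have int: "Re (\<phi> x) - Re (\<psi> x) \<in> \<int>" "Im (\<phi> x) - Im (\<psi> x) \<in> \<int>" if "x \<in> S" for x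
    using assms(4)[OF that] by (auto simp: plane_torus_def torus_proj_eq_iff)
  obtain a where a: "\<And>x. x \<in> S \<Longrightarrow> Re (\<phi> x) - Re (\<psi> x) = of_int a"
    by (rule continuous_Ints_valued_constant[of S "\<lambda>x. Re (\<phi> x) - Re (\<psi> x)"])
      (use assms int in \<open>auto intro!: continuous_intros\<close>)
  obtain b where b: "\<And>x. x \<in> S \<Longrightarrow> Im (\<phi> x) - Im (\<psi> x) = of_int b"
    by (rule continuous_Ints_valued_constant[of S "\<lambda>x. Im (\<phi> x) - Im (\<psi> x)"])
      (use assms int in \<open>auto intro!: continuous_intros\<close>)
  show thesis using that[of a b] a b by (force simp: complex_eq_iff algebra_simps)
qed

text \<open>The whole homotopy is lifted at once. The lattice vector by which the lift responds to a
  translation is constant on the connected product with \<open>{0..1}\<close>, so it can be read off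
  at time 1, where the lift is a shear up to a translation.\<close>

lemma dehn_homotopic_lift:
  fixes f :: "torus \<Rightarrow> torus"
  assumes "homotopic_with_canon (\<lambda>_. True) UNIV UNIV f (dehn_twist k)"
  obtains P where "continuous_on UNIV P" "\<And>z. plane_torus (P z) = f (plane_torus z)"
    "\<And>z a b. P (z + lattice_pt a b) = P z + lattice_pt (a + k * b) b"
proof -
  obtain h where "continuous_map (prod_topology (top_of_set {0..1::real}) (top_of_set UNIV)) (top_of_set UNIV) h"
    and h01: "\<And>x. h (0, x) = f x" "\<And>x. h (1, x) = dehn_twist k x"
    using assms unfolding homotopic_with_def by blast
  then have "continuous_on ({0..1} \<times> UNIV) h"
    unfolding prod_topology_subtopology_eu continuous_map_subtopology_eu by blast
  note h = this h01
  define S where "S = {0..1::real} \<times> (UNIV :: complex set)"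
  have S: "convex S" "connected S" unfolding S_def
    by (auto intro!: convex_Times connected_Times convex_connected)
  have "continuous_on S (\<lambda>p. h (fst p, plane_torus (snd p)))"
    by (rule continuous_on_compose2[OF h(1)])
      (auto simp: S_def intro!: continuous_intros continuous_on_compose2[OF continuous_plane_torus])
  then obtain \<psi> where \<psi>: "continuous_on S \<psi>" "\<And>p. p \<in> S \<Longrightarrow> plane_torus (\<psi> p) = h (fst p, plane_torus (snd p))"
    using torus_map_lift S(1) by blast
  have sl: "continuous_on UNIV (\<lambda>z. \<psi> (t, z))" if "t \<in> {0..1}" for t
    by (rule continuous_on_compose2[OF \<psi>(1)]) (use that in \<open>auto simp: S_def intro!: continuous_intros\<close>)
  have dehn: "dehn_twist k (plane_torus z) = plane_torus (z + of_real (of_int k * Im z))" for z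
    unfolding plane_torus_def dehn_twist_torus_proj by simp
  obtain c d where cd: "\<And>z. \<psi> (1, z) = (z + of_real (of_int k * Im z)) + lattice_pt c d"
  proof (rule torus_lifts_differ_by_lattice[of UNIV "\<lambda>z. \<psi> (1, z)" "\<lambda>z. z + of_real (of_int k * Im z)"])
    show "continuous_on UNIV (\<lambda>z. \<psi> (1, z))" by (rule sl) simp
    show "plane_torus (\<psi> (1, z)) = plane_torus (z + of_real (of_int k * Im z))" for z
      using \<psi>(2)[of "(1, z)"] by (simp add: S_def h(3) dehn)
  qed (auto intro!: continuous_intros)
  have per: "\<psi> (0, z + lattice_pt a b) = \<psi> (0, z) + lattice_pt (a + k * b) b" for z a b
  proof -
    obtain m n where mn: "\<And>p. p \<in> S \<Longrightarrow> \<psi> (fst p, snd p + lattice_pt a b) = \<psi> p + lattice_pt m n"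
    proof (rule torus_lifts_differ_by_lattice[of S "\<lambda>p. \<psi> (fst p, snd p + lattice_pt a b)" \<psi>])
      show "continuous_on S (\<lambda>p. \<psi> (fst p, snd p + lattice_pt a b))"
        by (rule continuous_on_compose2[OF \<psi>(1)]) (auto simp: S_def intro!: continuous_intros)
      have "plane_torus (w + lattice_pt a b) = plane_torus w" for w
        unfolding plane_torus_eq_iff by blast
      then show "plane_torus (\<psi> (fst p, snd p + lattice_pt a b)) = plane_torus (\<psi> p)" if "p \<in> S" for p
        using that \<psi>(2)[of p] \<psi>(2)[of "(fst p, snd p + lattice_pt a b)"] by (auto simp: S_def)
    qed (use S \<psi> in auto)
    have "lattice_pt m n = lattice_pt (a + k * b) b"
      using mn[of "(1, 0)"] cd[of "lattice_pt a b"] cd[of 0] by (auto simp: S_def complex_eq_iff)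
    then show ?thesis using mn[of "(0, z)"] by (simp add: S_def)
  qed
  show thesis
  proof (rule that[of "\<lambda>z. \<psi> (0, z)"])
    show "continuous_on UNIV (\<lambda>z. \<psi> (0, z))" by (rule sl) simp
    show "plane_torus (\<psi> (0, z)) = f (plane_torus z)" for z
      using \<psi>(2)[of "(0, z)"] by (simp add: S_def h(2))
  qed (rule per)
qed

text \<open>A lift \<open>Q\<close> of the inverse composes with \<open>P\<close> on either side to
  a lift of the identity, that is, to a lattice translation. One side makes \<open>P\<close>
  injective, the other corrects \<open>Q\<close> to a true inverse.\<close>

lemma lift_homeomorphism:
  assumes "homeomorphism UNIV UNIV f g" "continuous_on UNIV P" "\<And>z. plane_torus (P z) = f (plane_torus z)"
    and P_inj: "\<And>z a b. plane_torus (P (z + lattice_pt a b)) = plane_torus (P z)"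
  shows "\<exists>Q. homeomorphism UNIV UNIV P Q"
proof -
  have fg: "f (g u) = u" "g (f u) = u" and cg: "continuous_on UNIV g" for u
    using homeomorphism_apply1[OF assms(1)] homeomorphism_apply2[OF assms(1)]
      homeomorphism_cont2[OF assms(1)] by auto
  have "continuous_on UNIV (\<lambda>z. g (plane_torus z))"
    by (rule continuous_on_compose2[OF cg continuous_plane_torus]) auto
  then obtain Q where Q: "continuous_on UNIV Q" "\<And>z. plane_torus (Q z) = g (plane_torus z)"
    using torus_map_lift[of UNIV "\<lambda>z. g (plane_torus z)"] by auto
  obtain a b where PQ: "\<And>z. P (Q z) = z + lattice_pt a b"
    by (rule torus_lifts_differ_by_lattice[of UNIV "\<lambda>z. P (Q z)" "\<lambda>z. z"])
      (auto intro!: continuous_on_compose2[OF assms(2) Q(1)] continuous_intros simp: assms(3) Q(2) fg)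
  obtain c d where QP: "\<And>z. Q (P z) = z + lattice_pt c d"
    by (rule torus_lifts_differ_by_lattice[of UNIV "\<lambda>z. Q (P z)" "\<lambda>z. z"])
      (auto intro!: continuous_on_compose2[OF Q(1) assms(2)] continuous_intros simp: assms(3) Q(2) fg)
  have inj: "z = w" if "P z = P w" for z w
    using arg_cong[OF that, of Q] unfolding QP by simp
  have PQ': "P (Q (z - lattice_pt a b)) = z" for z using PQ[of "z - lattice_pt a b"] by simp
  have QP': "Q (P z - lattice_pt a b) = z" for z by (rule inj) (rule PQ')
  have "homeomorphism UNIV UNIV P (\<lambda>z. Q (z - lattice_pt a b))"
    by (intro homeomorphismI assms(2) continuous_on_compose2[OF Q(1)] continuous_intros PQ' QP') auto
  then show ?thesis by blast
qed

text \<open>Both sides cover \<open>f\<close>, so their heights differ by a continuous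
  integer-valued function on the plane, which is constant.\<close>

lemma cylinder_lift:
  assumes "is_lift F f" "continuous_on UNIV P" "\<And>z. plane_torus (P z) = f (plane_torus z)"
  obtains c where "\<And>z. F (plane_cylinder z) = plane_cylinder (P z + lattice_pt 0 c)"
proof -
  have F: "continuous_on UNIV F" "\<And>u. cylinder_proj (F u) = f (cylinder_proj u)"
    using assms(1) unfolding is_lift_def by (auto simp: fun_eq_iff)
  have "cylinder_proj (plane_cylinder z) = plane_torus z" for z
    by (simp add: cylinder_proj_def plane_cylinder_def plane_torus_eq)
  then have 1: "cylinder_proj (F (plane_cylinder z)) = plane_torus (P z)" for z
    by (simp add: F(2) assms(3))
  then have 2: "fst (F (plane_cylinder z)) = to_circle (Re (P z))"
    "to_circle (snd (F (plane_cylinder z))) = to_circle (Im (P z))" for z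
    by (metis cylinder_proj_def fst_conv fst_map_prod id_apply plane_torus_eq)
      (metis 1 cylinder_proj_def snd_conv snd_map_prod plane_torus_eq)
  obtain c :: int where c: "\<And>z. snd (F (plane_cylinder z)) - Im (P z) = of_int c"
  proof (rule continuous_Ints_valued_constant[of UNIV "\<lambda>z. snd (F (plane_cylinder z)) - Im (P z)"])
    show "continuous_on UNIV (\<lambda>z. snd (F (plane_cylinder z)) - Im (P z))"
      by (intro continuous_intros continuous_on_compose2[OF F(1) continuous_plane_cylinder] assms(2)) auto
    show "snd (F (plane_cylinder z)) - Im (P z) \<in> \<int>" for z
      using 2(2)[of z] by (simp add: to_circle_eq_iff)
  qed auto
  have "F (plane_cylinder z) = plane_cylinder (P z + lattice_pt 0 c)" for z
    using c[of z] 2(1)[of z] by (simp add: plane_cylinder_def prod_eq_iff)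
  then show thesis by (rule that)
qed

section \<open>Forward invariant sets of a minimal homeomorphism\<close>

lemma compact_torus: "compact (UNIV :: torus set)"
proof -
  have "(UNIV :: torus set) = plane_torus ` cbox 0 (Complex 1 1)"
  proof (rule sym, rule equalityI[OF subset_UNIV], rule subsetI)
    fix u
    obtain z where u: "u = plane_torus z" by (rule surj_plane_torus)
    obtain w a b where w: "w \<in> cbox 0 (Complex 1 1)" "z = w + lattice_pt a b"
      by (rule lattice_decompose)
    then have "plane_torus z = plane_torus w" unfolding plane_torus_eq_iff by blast
    then show "u \<in> plane_torus ` cbox 0 (Complex 1 1)" using u w by blast
  qed
  moreover have "compact (plane_torus ` cbox 0 (Complex 1 1))"
    by (intro compact_continuous_image compact_cbox continuous_plane_torus)
  ultimately show ?thesis by metis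
qed

text \<open>Minimality concerns two-sided orbits, while \<open>M\<close> is only forward invariant.
  By compactness the nested images of \<open>M\<close> under the powers of \<open>f\<close> have a
  common point. Their intersection is invariant in both directions, so it contains a full orbit and
  is everything.\<close>

lemma minimal_homeo_forward_invariant:
  assumes "homeomorphism UNIV UNIV f g" "minimal_homeo f" "compact (UNIV :: 'a::topological_space set)"
    and "closed M" "M \<noteq> {}" "\<And>u. u \<in> M \<Longrightarrow> f u \<in> M"
  shows "M = (UNIV :: 'a set)"
proof -
  have fg: "f (g u) = u" "g (f u) = u" and cg: "continuous_on UNIV g" for u
    using homeomorphism_apply1[OF assms(1)] homeomorphism_apply2[OF assms(1)]
      homeomorphism_cont2[OF assms(1)] by auto
  have inv: "inv f = g" by (rule inv_equality) (simp_all add: fg)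
  have cgn: "continuous_on UNIV (g ^^ n)" for n
    by (induction n) (auto intro!: continuous_on_compose2[OF cg])
  \<comment> \<open>This is the image of \<open>M\<close> under \<open>f ^^ n\<close>, written as a
    preimage so that it is visibly closed.\<close>
  define N where "N = (\<lambda>n. (g ^^ n) -` M)"
  have clN: "closed (N n)" for n unfolding N_def by (rule closed_vimage[OF assms(4) cgn])
  have N_Suc: "N (Suc n) \<subseteq> N n" for n
  proof
    fix u assume "u \<in> N (Suc n)"
    then have "f (g ((g ^^ n) u)) \<in> M" using assms(6) by (auto simp: N_def)
    then show "u \<in> N n" by (simp add: N_def fg)
  qed
  have N_anti: "N m \<subseteq> N n" if "n \<le> m" for n m
    using lift_Suc_antimono_le[of N] N_Suc that by blast
  have fNm: "(f ^^ n) u \<in> N n" if "u \<in> M" for u n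
  proof -
    have "(g ^^ n) ((f ^^ n) u) = u" for u by (induction n arbitrary: u) (simp_all add: fg funpow_swap1)
    then show ?thesis using that by (simp add: N_def)
  qed
  obtain u0 where u0: "u0 \<in> M" using assms(5) by blast
  have "UNIV \<inter> (\<Inter>n\<in>UNIV. N n) \<noteq> {}"
  proof (rule compact_imp_fip_image[OF assms(3)])
    fix I :: "nat set" assume "finite I"
    then have "(f ^^ (Max (insert 0 I))) u0 \<in> N i" if "i \<in> I" for i
      using fNm[OF u0] N_anti that by (meson Max_ge finite_insert insertCI subsetD)
    then show "UNIV \<inter> (\<Inter>i\<in>I. N i) \<noteq> {}" by blast
  qed (rule clN)
  then obtain u where u: "\<And>n. u \<in> N n" by blast
  define K where "K = (\<Inter>n. N n)"
  have fK: "f v \<in> K" if "v \<in> K" for v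
  proof -
    have "f v \<in> N n" for n
    proof -
      have "(g ^^ Suc n) (f v) = (g ^^ n) v" unfolding funpow_Suc_right by (simp add: fg)
      moreover have "v \<in> N n" using that by (auto simp: K_def)
      ultimately have "f v \<in> N (Suc n)" by (simp add: N_def del: funpow.simps)
      then show ?thesis using N_Suc by blast
    qed
    then show ?thesis by (simp add: K_def)
  qed
  have gK: "g v \<in> K" if "v \<in> K" for v
  proof -
    have "v \<in> N (Suc n)" for n using that by (auto simp: K_def)
    then show ?thesis by (simp add: K_def N_def funpow_swap1)
  qed
  have "(f ^^ n) u \<in> K" "(g ^^ n) u \<in> K" for n
    using u by (induction n) (auto simp: fK gK, auto simp: K_def)
  then have "full_orbit f u \<subseteq> K" by (auto simp: full_orbit_def inv)
  moreover have "closed K" unfolding K_def using clN by blast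
  ultimately have "K = UNIV" using assms(2) closure_minimal unfolding minimal_homeo_def by blast
  then have "N 0 = UNIV" unfolding K_def by blast
  then show ?thesis by (simp add: N_def)
qed

lemma closed_plane_torus_image:
  assumes "closed S" "\<And>z a b. z \<in> S \<Longrightarrow> z + lattice_pt a b \<in> S"
  shows "closed (plane_torus ` S)" "plane_torus z \<in> plane_torus ` S \<longleftrightarrow> z \<in> S"
proof -
  show iff: "plane_torus z \<in> plane_torus ` S \<longleftrightarrow> z \<in> S" for z
    using assms(2) by (auto simp: plane_torus_eq_iff)
  have "torus_proj -` (- plane_torus ` S) = (\<lambda>p. Complex (fst p) (snd p)) -` (- S)"
  proof (rule set_eqI)
    fix p
    have "torus_proj p = plane_torus (Complex (fst p) (snd p))" by (simp add: plane_torus_def)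
    then show "p \<in> torus_proj -` (- plane_torus ` S) \<longleftrightarrow> p \<in> (\<lambda>p. Complex (fst p) (snd p)) -` (- S)"
      using iff by simp
  qed
  also have "open \<dots>" using assms(1) by (intro open_vimage continuous_intros) auto
  finally show "closed (plane_torus ` S)" unfolding closed_def open_torus_iff .
qed

theorem theorem1:
  fixes f :: "torus \<Rightarrow> torus" and F :: "cylinder \<Rightarrow> cylinder"
  assumes "f \<in> DT_torus"
    and "F \<in> DT_cylinder"
    and "is_lift F f"
    and "minimal_homeo f"
  shows "\<exists>\<alpha>::real. \<alpha> \<notin> \<rat> \<and> vertical_rotation_set F = {\<alpha>}"
proof -
  obtain g k where g: "homeomorphism UNIV UNIV f g" and "k \<noteq> 0"
    and hom: "homotopic_with_canon (\<lambda>_. True) UNIV UNIV f (dehn_twist k)"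
    using assms(1) by (auto simp: DT_torus_def)
  obtain P0 where P0: "continuous_on UNIV P0" "\<And>z. plane_torus (P0 z) = f (plane_torus z)"
    "\<And>z a b. P0 (z + lattice_pt a b) = P0 z + lattice_pt (a + k * b) b"
    using dehn_homotopic_lift[OF hom] by blast
  obtain c where c: "\<And>z. F (plane_cylinder z) = plane_cylinder (P0 z + lattice_pt 0 c)"
    using cylinder_lift[OF assms(3) P0(1,2)] by blast
  \<comment> \<open>The vertical translation makes \<open>P\<close> a lift of \<open>F\<close>
    itself and not only of \<open>f\<close>; without it the rotation set would be shifted by the
    integer \<open>c\<close>.\<close>
  define P where "P = (\<lambda>z. P0 z + lattice_pt 0 c)"
  have P_torus: "plane_torus (P z) = f (plane_torus z)" for z
  proof -
    have "plane_torus (P z) = plane_torus (P0 z)" unfolding P_def plane_torus_eq_iff by blast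
    then show ?thesis by (simp add: P0(2))
  qed
  have P_add: "P (z + lattice_pt a b) = P z + lattice_pt (a + k * b) b" for z a b
    by (simp add: P_def P0(3))
  interpret minimal_twist P k
  proof
    show "\<exists>Q. homeomorphism UNIV UNIV P Q"
    proof (rule lift_homeomorphism[OF g _ P_torus])
      show "continuous_on UNIV P" unfolding P_def by (intro continuous_intros P0(1))
      show "plane_torus (P (z + lattice_pt a b)) = plane_torus (P z)" for z a b
        unfolding P_add plane_torus_eq_iff by blast
    qed
    show "P (z + lattice_pt a b) = P z + lattice_pt (a + k * b) b" for z a b by (rule P_add)
    show "k \<noteq> 0" by fact
    fix S assume S: "closed S" "S \<noteq> {}" "\<And>z a b. z \<in> S \<Longrightarrow> z + lattice_pt a b \<in> S" "\<And>z. z \<in> S \<Longrightarrow> P z \<in> S"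
    have "plane_torus ` S = UNIV"
    proof (rule minimal_homeo_forward_invariant[OF g assms(4) compact_torus])
      show "closed (plane_torus ` S)" by (rule closed_plane_torus_image[OF S(1,3)])
      show "f u \<in> plane_torus ` S" if "u \<in> plane_torus ` S" for u
        using that S(4) by (auto simp flip: P_torus)
    qed (use S(2) in auto)
    then show "S = UNIV" using closed_plane_torus_image(2)[OF S(1,3)] by blast
  qed
  have it: "(F ^^ n) (plane_cylinder z) = plane_cylinder ((P ^^ n) z)" for n z
    by (induction n) (simp_all add: c P_def)
  \<comment> \<open>\<open>plane_cylinder\<close> is onto, preserves heights and intertwines
    \<open>P\<close> with \<open>F\<close>.\<close>
  have "{(snd ((F ^^ n) z) - snd z) / real n | z. True} = mean_displacements n" for n
  proof -
    have snd: "snd (plane_cylinder z) = Im z" for z by (simp add: plane_cylinder_def)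
    have "(snd ((F ^^ n) u) - snd u) / real n \<in> mean_displacements n" for u
    proof -
      obtain z where u: "u = plane_cylinder z" by (rule surj_plane_cylinder)
      show ?thesis unfolding u it snd mean_displacements_def by blast
    qed
    moreover have "\<exists>u. x = (snd ((F ^^ n) u) - snd u) / real n" if x: "x \<in> mean_displacements n" for x
    proof -
      obtain z where "x = (Im ((P ^^ n) z) - Im z) / real n"
        using x unfolding mean_displacements_def by blast
      then show ?thesis by (intro exI[of _ "plane_cylinder z"]) (simp add: it snd)
    qed
    ultimately show ?thesis by blast
  qed
  then have "vertical_rotation_set F = (\<Inter>i\<in>{1..}. closure (\<Union>n\<in>{i..}. mean_displacements n))"
    by (simp add: vertical_rotation_set_def)
  then show ?thesis using rotation_set_irrational_singleton by metis
qed

end
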